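(* The optimization problem $$\min_{H^1,H^2}\ \mathrm{WS}_{c,p}\left(\left(H^2\circ H^1\right)_{\#}\mathbb P^t,\ \mathbb P^s\right)$$ is equivalent to the following optimization problem: $$\min_{H^1,H^2}\ \ \min_{G^1:\ H^1_{\#}\mathbb P^t=G^1_{\#}\mathbb P^s}\ \mathbb E_{\boldsymbol{x}\sim\mathbb P^s}\left[c\left(\boldsymbol{x},H^2\left(G^1(\boldsymbol{x})\right)\right)^p\right]^{1/p},$$ where $G^1$ is an injective map from the source domain $\mathcal X^s$ to the joint space $\mathcal Z$.
   Context: $\mathcal X^s$ and $\mathcal X^t$ are the source and target data spaces, with data-generating probability measures $\mathbb P^s$ on $\mathcal X^s$ and $\mathbb P^t$ on $\mathcal X^t$. $\mathcal Z=\mathbb R^m$ is an intermediate space, called the joint space. In both problems $H^1$ is an injective mapping from the target domain $\mathcal X^t$ to $\mathcal Z$, and $H^2$ maps from $\mathcal Z$ to the source domain $\mathcal X^s$. $c$ is a cost function (or metric) and $p>0$. $f_{\#}\mu$ denotes the pushforward of a measure $\mu$ under a map $f$. Wasserstein distance between two distributions $\mathbb P$ and $\mathbb Q$: $\mathrm{WS}_{c,p}(\mathbb P,\mathbb Q)=\inf_{T_{\#}\mathbb P=\mathbb Q}\mathbb E_{\boldsymbol{x}\sim\mathbb P}\left[c(\boldsymbol{x},T(\boldsymbol{x}))^p\right]^{1/p}$, the infimum being over maps $T$ with $T_{\#}\mathbb P=\mathbb Q$.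
   Formalization: Equivalent means same optimal value and, if c is also continuous with c(x,y)=0 only for x=y, the same optimal (H^1,H^2). Added: c≥0, c(x,x)=0, and some injective H^1, G^1 satisfy the constraint. Without these the claim fails, e.g. P^s a point mass and P^t uniform. *)

theory Defs
  imports "HOL-Analysis.Analysis" "HOL-Probability.Probability"
begin

text \<open>
  Costs live in \<^typ>\<open>ennreal\<close>: a cost that is not integrable has expectation \<open>\<infinity>\<close> (the Bochner
  integral would be 0), and an infimum over an empty set of transport maps is \<open>\<infinity>\<close>.
\<close>

definition ennreal_powr :: "ennreal \<Rightarrow> real \<Rightarrow> ennreal" where
  "ennreal_powr a r = (if a = \<infinity> then \<infinity> else ennreal (enn2real a powr r))"

definition expected_cost ::
    "('x \<Rightarrow> 'x \<Rightarrow> real) \<Rightarrow> real \<Rightarrow> 'x measure \<Rightarrow> ('x \<Rightarrow> 'x) \<Rightarrow> ennreal" where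
  "expected_cost c p P T =
     ennreal_powr (\<integral>\<^sup>+x. ennreal (c x (T x) powr p) \<partial>P) (1 / p)"

definition transport_maps :: "'x measure \<Rightarrow> 'y measure \<Rightarrow> ('x \<Rightarrow> 'y) set" where
  "transport_maps P Q = {T \<in> P \<rightarrow>\<^sub>M Q. distr P Q T = Q}"

definition WS ::
    "('x \<Rightarrow> 'x \<Rightarrow> real) \<Rightarrow> real \<Rightarrow> 'x measure \<Rightarrow> 'x measure \<Rightarrow> ennreal" where
  "WS c p P Q = (INF T\<in>transport_maps P Q. expected_cost c p P T)"

definition injective_maps :: "'x measure \<Rightarrow> ('x \<Rightarrow> 'z::topological_space) set" where
  "injective_maps M = {H \<in> borel_measurable M. inj_on H (space M)}"

definition matching_maps ::
    "'t measure \<Rightarrow> 's measure \<Rightarrow> ('t \<Rightarrow> 'z::topological_space) \<Rightarrow> ('s \<Rightarrow> 'z) set" where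
  "matching_maps Pt Ps H1 = {G1 \<in> injective_maps Ps. distr Pt borel H1 = distr Ps borel G1}"

definition admissible_pairs ::
    "'t measure \<Rightarrow> 's measure \<Rightarrow> (('t \<Rightarrow> 'z::topological_space) \<times> ('z \<Rightarrow> 's)) set" where
  "admissible_pairs Pt Ps = injective_maps Pt \<times> (borel \<rightarrow>\<^sub>M Ps)"

definition WS_objective ::
    "('s \<Rightarrow> 's \<Rightarrow> real) \<Rightarrow> real \<Rightarrow> 't measure \<Rightarrow> 's measure \<Rightarrow>
     ('t \<Rightarrow> 'z::topological_space) \<times> ('z \<Rightarrow> 's) \<Rightarrow> ennreal" where
  "WS_objective c p Pt Ps = (\<lambda>(H1, H2). WS c p (distr Pt Ps (H2 \<circ> H1)) Ps)"

definition reconstruction_objective ::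
    "('s \<Rightarrow> 's \<Rightarrow> real) \<Rightarrow> real \<Rightarrow> 't measure \<Rightarrow> 's measure \<Rightarrow>
     ('t \<Rightarrow> 'z::topological_space) \<times> ('z \<Rightarrow> 's) \<Rightarrow> ennreal" where
  "reconstruction_objective c p Pt Ps =
     (\<lambda>(H1, H2). INF G1\<in>matching_maps Pt Ps H1. expected_cost c p Ps (H2 \<circ> G1))"

end

theory Submission
  imports Defs
begin

text \<open>
  Feasibility makes both infima \<open>0\<close>: a Borel left inverse of \<open>G\<^sup>1\<close>, which exists outside a null set,
  reconstructs \<open>x\<close> exactly. So a pair is a minimiser iff its objective vanishes, and it remains to see
  that either objective vanishes iff \<open>H\<^sup>2 \<circ> H\<^sup>1\<close> pushes \<open>P\<^sup>t\<close> to \<open>P\<^sup>s\<close>. Two laws at transport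
  cost \<open>0\<close> coincide, because disjoint compact sets are at positive cost from each other. Conversely,
  suppose that \<open>H\<^sup>2\<close> pushes \<open>\<mu> = H\<^sup>1\<^sub># P\<^sup>t\<close> to \<open>P\<^sup>s\<close>. By injectivity, \<open>\<mu>\<close> and \<open>P\<^sup>s\<close> both have the
  atoms of \<open>P\<^sup>t\<close>, so the sums of the squares of their atoms agree, and \<open>H\<^sup>2\<close> must match the atoms
  one to one. Cut \<open>X\<^sup>s\<close> into the atoms and countably many diffuse pieces on which \<open>c < \<epsilon>\<close>; each
  piece is isomorphic, up to null sets, to its preimage under \<open>H\<^sup>2\<close>, and gluing the isomorphisms
  yields an injective \<open>G\<^sup>1\<close> with \<open>c x (H\<^sup>2 (G\<^sup>1 x)) < \<epsilon>\<close> almost everywhere. On the exceptional null set,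
  injectivity is restored by a Borel injection into a \<open>\<mu>\<close>-null Cantor set.
\<close>

section \<open>Ternary expansions and Borel injections\<close>

text \<open>Base 3 with digits 0 and 1 only: the tail behind a digit stays below one unit of its
  place, so expansions are unique and the bits can be read back.\<close>

definition ternary :: "(nat \<Rightarrow> bool) \<Rightarrow> real" where
  "ternary b = (\<Sum>n. of_bool (b n) / 3 ^ Suc n)"

text \<open>Reading a digit through a floor gives a Borel predicate on all reals, including those
  that are no value of \<open>ternary\<close>.\<close>

definition ternary_digit :: "nat \<Rightarrow> real \<Rightarrow> bool" where
  "ternary_digit n y \<longleftrightarrow> \<lfloor>3 ^ Suc n * y\<rfloor> mod 3 = 1"

lemma summable_ternary: "summable (\<lambda>n. of_bool (b n) / 3 ^ Suc n :: real)"
proof (rule summable_comparison_test')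
  show "summable (\<lambda>n. (1/3 :: real) ^ n)"
    by (rule summable_geometric) simp
  show "norm (of_bool (b n) / 3 ^ Suc n :: real) \<le> (1/3) ^ n" for n
    by (simp add: power_divide divide_simps)
qed

lemma ternary_nonneg: "0 \<le> ternary b"
  unfolding ternary_def by (rule suminf_nonneg[OF summable_ternary]) simp

lemma ternary_less_1: "ternary b < 1"
proof -
  have s: "(\<lambda>n. 1/3 * (1/3 :: real) ^ n) sums (1/3 * (1 / (1 - 1/3)))"
    by (intro sums_mult geometric_sums) simp
  have "ternary b \<le> (\<Sum>n. 1/3 * (1/3 :: real) ^ n)"
    unfolding ternary_def using s
    by (intro suminf_le summable_ternary) (auto simp: power_divide sums_iff)
  then show ?thesis using s by (simp add: sums_iff)
qed

lemma ternary_rec: "3 * ternary b = of_bool (b 0) + ternary (\<lambda>n. b (Suc n))"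
proof -
  have "ternary b = of_bool (b 0) / 3 + (\<Sum>n. of_bool (b (Suc n)) / 3 ^ Suc (Suc n))"
    unfolding ternary_def
    using suminf_split_head[OF summable_ternary[of b]] by simp
  also have "(\<Sum>n. of_bool (b (Suc n)) / 3 ^ Suc (Suc n) :: real)
      = (\<Sum>n. (of_bool (b (Suc n)) / 3 ^ Suc n) / 3)"
    by (simp add: mult.commute)
  also have "\<dots> = ternary (\<lambda>n. b (Suc n)) / 3"
    unfolding ternary_def by (rule suminf_divide[OF summable_ternary])
  finally show ?thesis by simp
qed

lemma ternary_digit_ternary [simp]: "ternary_digit n (ternary b) \<longleftrightarrow> b n"
proof (induction n arbitrary: b)
  case 0
  have "\<lfloor>3 * ternary b\<rfloor> = of_bool (b 0)"
    using ternary_nonneg[of "\<lambda>n. b (Suc n)"] ternary_less_1[of "\<lambda>n. b (Suc n)"]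
    by (intro floor_unique) (auto simp: ternary_rec)
  then show ?case by (simp add: ternary_digit_def)
next
  case (Suc n)
  let ?t = "ternary (\<lambda>n. b (Suc n))"
  have "3 ^ Suc (Suc n) * ternary b = 3 ^ Suc n * (3 * ternary b)" by simp
  also have "\<dots> = 3 ^ Suc n * (of_bool (b 0) + ?t)"
    by (simp only: ternary_rec)
  also have "\<dots> = of_int (3 ^ Suc n * of_bool (b 0)) + 3 ^ Suc n * ?t"
    by (simp add: distrib_left)
  finally have "\<lfloor>3 ^ Suc (Suc n) * ternary b\<rfloor> = 3 ^ Suc n * of_bool (b 0) + \<lfloor>3 ^ Suc n * ?t\<rfloor>"
    by (metis floor_add2 floor_of_int Ints_of_int)
  \<comment> \<open>The leading bit adds a multiple of 3 to the floor, which vanishes modulo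
    3.\<close>
  then have "ternary_digit (Suc n) (ternary b) \<longleftrightarrow> ternary_digit n ?t"
    by (simp add: ternary_digit_def mod_simps)
  then show ?case using Suc by simp
qed

lemma ternary_inject: "ternary a = ternary b \<longleftrightarrow> a = b"
proof
  assume "ternary a = ternary b"
  then have "a n = b n" for n by (metis ternary_digit_ternary)
  then show "a = b" by blast
qed simp

lemma measurable_ternary [measurable]:
  assumes "\<And>n. Measurable.pred M (\<lambda>x. b x n)"
  shows "(\<lambda>x. ternary (b x)) \<in> borel_measurable M"
  unfolding ternary_def using assms by measurable

lemma measurable_ternary_digit [measurable]: "Measurable.pred borel (ternary_digit n)"
  unfolding ternary_digit_def by measurable

lemma uncountable_range_ternary: "uncountable (range ternary)"
proof
  assume "countable (range ternary)"
  then have "countable (UNIV :: (nat \<Rightarrow> bool) set)"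
    by (rule countable_image_inj_on) (simp add: inj_def ternary_inject)
  then have "countable (UNIV :: nat set set)"
    by (rule countable_image_inj_on[where f="\<lambda>S n. n \<in> S", OF countable_subset[OF subset_UNIV]])
       (auto simp: inj_def fun_eq_iff)
  then show False
    using Cantors_theorem[of "UNIV :: nat set"]
    by (metis Pow_UNIV UNIV_not_empty uncountable_def)
qed

section \<open>Coding points by a countable basis\<close>

lemma separating_open_sequence:
  obtains B :: "nat \<Rightarrow> 'a::{second_countable_topology, t2_space} set"
  where "\<And>n. open (B n)" "\<And>U x. open U \<Longrightarrow> x \<in> U \<Longrightarrow> \<exists>n. x \<in> B n \<and> B n \<subseteq> U"
proof -
  obtain \<B> :: "'a set set" where B: "countable \<B>" "topological_basis \<B>"
    using ex_countable_basis by auto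
  have "\<B> \<noteq> {}"
    using topological_basisE[OF B(2) open_UNIV UNIV_I] by blast
  then show ?thesis
    using that[of "from_nat_into \<B>"] B
    by (metis from_nat_into from_nat_into_surj topological_basisE topological_basis_open)
qed

text \<open>Of two distinct points, one has an open neighbourhood missing the other, hence also some
  \<open>B n\<close>; so the membership bits determine the point.\<close>

lemma open_sequence_inject:
  fixes B :: "nat \<Rightarrow> 'a::t2_space set"
  assumes "\<And>U x. open U \<Longrightarrow> x \<in> U \<Longrightarrow> \<exists>n. x \<in> B n \<and> B n \<subseteq> U"
  shows "(\<forall>n. x \<in> B n \<longleftrightarrow> y \<in> B n) \<longleftrightarrow> x = y"
  using assms by (metis subsetD t1_space)

lemma ex_borel_injection_real:
  "\<exists>e :: 'a::{second_countable_topology, t2_space} \<Rightarrow> real. e \<in> borel_measurable borel \<and> inj e"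
proof -
  obtain B :: "nat \<Rightarrow> 'a set" where B: "\<And>n. open (B n)"
    "\<And>U x. open U \<Longrightarrow> x \<in> U \<Longrightarrow> \<exists>n. x \<in> B n \<and> B n \<subseteq> U"
    using separating_open_sequence by blast
  have [measurable]: "B n \<in> sets borel" for n using B(1) by simp
  show ?thesis
    using open_sequence_inject[OF B(2)]
    by (intro exI[of _ "\<lambda>x. ternary (\<lambda>n. x \<in> B n)"]) (auto simp: inj_def ternary_inject fun_eq_iff)
qed

text \<open>
  Freezing the odd ternary digits to a sequence \<open>\<sigma>\<close> and letting the even digits code a point gives
  uncountably many disjoint Borel sets, each large enough to hold a copy of the whole space.
\<close>

lemma ex_borel_injection_null_set:
  fixes N :: "(real ^ 'm) measure"
  assumes "finite_measure N" and "sets N = sets borel"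
  shows "\<exists>(k :: 'a::{second_countable_topology, t2_space} \<Rightarrow> real ^ 'm) C.
    k \<in> borel_measurable borel \<and> inj k \<and> range k \<subseteq> C \<and> C \<in> sets borel \<and> emeasure N C = 0"
proof -
  interpret finite_measure N by fact
  obtain B :: "nat \<Rightarrow> 'a set" where B: "\<And>n. open (B n)"
    "\<And>U x. open U \<Longrightarrow> x \<in> U \<Longrightarrow> \<exists>n. x \<in> B n \<and> B n \<subseteq> U"
    using separating_open_sequence by blast
  have [measurable]: "B n \<in> sets borel" for n using B(1) by simp
  obtain i0 :: 'm where True by simp
  \<comment> \<open>\<open>h\<close> re-encodes the odd digits of one fixed coordinate; its fibres
    over the values \<open>ternary \<sigma>\<close> are the disjoint sets among which a null one is
    sought.\<close>
  define h where "h = (\<lambda>z::real^'m. ternary (\<lambda>n. ternary_digit (2 * n + 1) (z $ i0)))"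
  have h[measurable]: "h \<in> borel_measurable borel" unfolding h_def by measurable
  have h': "h \<in> borel_measurable N" using h assms(2) by (simp cong: measurable_cong_sets)
  interpret D: finite_measure "distr N borel h" by (rule finite_measure_distr[OF h'])
  \<comment> \<open>A finite measure has only countably many atoms, while the range of
    \<open>ternary\<close> is uncountable.\<close>
  have "\<not> range ternary \<subseteq> {x. measure (distr N borel h) {x} \<noteq> 0}"
    using D.countable_support uncountable_range_ternary countable_subset by blast
  then obtain \<sigma> where \<sigma>: "measure (distr N borel h) {ternary \<sigma>} = 0" by auto
  define C where "C = h -` {ternary \<sigma>}"
  have C: "C \<in> sets borel" unfolding C_def using measurable_sets[OF h, of "{ternary \<sigma>}"] by simp
  have "measure N C = 0"
    using \<sigma> h' assms(2) by (simp add: measure_distr C_def sets_eq_imp_space_eq[OF assms(2)])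
  then have NC: "emeasure N C = 0" by (simp add: emeasure_eq_measure)
  \<comment> \<open>Position \<open>2 * n\<close> carries the basis bit \<open>n\<close> of the
    point and position \<open>2 * n + 1\<close> carries \<open>\<sigma> n\<close>; all coordinates
    agree, so \<open>i0\<close> is among the coded ones.\<close>
  define k :: "'a \<Rightarrow> real ^ 'm" where
    "k = (\<lambda>x. ternary (\<lambda>n. if even n then x \<in> B (n div 2) else \<sigma> (n div 2)) *\<^sub>R 1)"
  have kb: "k \<in> borel_measurable borel" unfolding k_def by measurable
  have "range k \<subseteq> C" by (auto simp: C_def h_def k_def)
  moreover have "inj k"
  proof
    fix x y assume "k x = k y"
    then have "(if even n then x \<in> B (n div 2) else \<sigma> (n div 2)) =
      (if even n then y \<in> B (n div 2) else \<sigma> (n div 2))" for n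
      by (simp add: k_def vec_eq_iff ternary_inject fun_eq_iff)
    from this[of "2 * n" for n] show "x = y"
      using open_sequence_inject[OF B(2)] by auto
  qed
  ultimately show ?thesis using kb C NC by blast
qed

section \<open>Almost everywhere Borel left inverses\<close>

text \<open>The supremum form of inner regularity, turned into an error bound.\<close>

lemma finite_measure_inner_approx:
  fixes M :: "'a::polish_space measure"
  assumes "finite_measure M" "sets M = sets borel" "A \<in> sets borel" "0 < (e::real)"
  obtains K where "K \<subseteq> A" "compact K" "measure M (A - K) < e"
proof -
  interpret finite_measure M by fact
  have sup: "emeasure M A = (SUP K\<in>{K. K \<subseteq> A \<and> compact K}. emeasure M K)"
    by (rule inner_regular) (use assms emeasure_finite in auto)
  show thesis
  proof (cases "measure M A < e")
    case True
    then show ?thesis using that[of "{}"] by simp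
  next
    case False
    then have "ennreal (measure M A - e) < emeasure M A"
      using assms(4) by (simp add: emeasure_eq_measure ennreal_less_iff)
    then obtain K where K: "K \<subseteq> A" "compact K" "ennreal (measure M A - e) < emeasure M K"
      unfolding sup by (auto simp: less_SUP_iff)
    have KM: "K \<in> sets M" "A \<in> sets M" using K(2) assms by (auto intro: borel_compact)
    have "measure M A - e < measure M K"
      using K(3) False by (simp add: emeasure_eq_measure ennreal_less_iff)
    then show ?thesis
      using that[of K] K KM by (simp add: finite_measure_Diff)
  qed
qed

text \<open>Lusin's theorem through a countable basis: the preimage of each basic set and its
  complement in \<open>X\<close> are approximated from inside by compact sets, and \<open>g\<close>
  is continuous on the points covered for every index.\<close>

lemma lusin_compact:
  fixes M :: "'a::polish_space measure" and g :: "'a \<Rightarrow> 'b::{second_countable_topology, t2_space}"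
  assumes M: "finite_measure M" "sets M = sets borel" and X: "X \<in> sets borel"
    and g: "g \<in> borel_measurable borel" and e: "0 < (e::real)"
  obtains K where "K \<subseteq> X" "compact K" "continuous_on K g" "measure M (X - K) \<le> e"
proof -
  interpret finite_measure M by fact
  obtain B :: "nat \<Rightarrow> 'b set" where B: "\<And>n. open (B n)"
    "\<And>U x. open U \<Longrightarrow> x \<in> U \<Longrightarrow> \<exists>n. x \<in> B n \<and> B n \<subseteq> U"
    using separating_open_sequence by blast
  have pre: "g -` U \<in> sets borel" if "open U" for U
    using measurable_sets[OF g, of U] that by simp
  define d where "d n = e * (1/2) ^ Suc n / 2" for n
  have d: "d n > 0" for n using e by (simp add: d_def)
  have "\<forall>n. \<exists>K. K \<subseteq> X \<inter> g -` B n \<and> compact K \<and> measure M (X \<inter> g -` B n - K) < d n"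
  proof
    fix n
    show "\<exists>K. K \<subseteq> X \<inter> g -` B n \<and> compact K \<and> measure M (X \<inter> g -` B n - K) < d n"
      by (rule finite_measure_inner_approx[OF M sets.Int[OF X pre[OF B(1)[of n]]] d[of n]]) blast
  qed
  from choice[OF this] obtain P where P: "\<And>n. P n \<subseteq> X \<inter> g -` B n" "\<And>n. compact (P n)"
    "\<And>n. measure M (X \<inter> g -` B n - P n) < d n" by blast
  have "\<forall>n. \<exists>K. K \<subseteq> X - g -` B n \<and> compact K \<and> measure M (X - g -` B n - K) < d n"
  proof
    fix n
    show "\<exists>K. K \<subseteq> X - g -` B n \<and> compact K \<and> measure M (X - g -` B n - K) < d n"
      by (rule finite_measure_inner_approx[OF M sets.Diff[OF X pre[OF B(1)[of n]]] d[of n]]) blast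
  qed
  from choice[OF this] obtain Q where Q: "\<And>n. Q n \<subseteq> X - g -` B n" "\<And>n. compact (Q n)"
    "\<And>n. measure M (X - g -` B n - Q n) < d n" by blast
  define K where "K = (\<Inter>n. P n \<union> Q n)"
  have "K \<subseteq> X" unfolding K_def using P(1) Q(1) by blast
  moreover have "compact K"
  proof -
    have "closed K" unfolding K_def
      using P(2) Q(2) by (intro closed_INT ballI closed_Un compact_imp_closed) auto
    \<comment> \<open>\<open>K\<close> is a closed part of its own factor with index 0, which is
      compact.\<close>
    then have "compact ((P 0 \<union> Q 0) \<inter> K)"
      using P(2) Q(2) by (intro compact_Int_closed compact_Un) auto
    moreover have "(P 0 \<union> Q 0) \<inter> K = K" by (auto simp: K_def)
    ultimately show ?thesis by simp
  qed
  moreover have "continuous_on K g"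
    unfolding continuous_on_open_invariant
  proof (intro allI impI)
    fix U :: "'b set" assume U: "open U"
    define J where "J = {n. B n \<subseteq> U}"
    have UJ: "U = (\<Union>n\<in>J. B n)" unfolding J_def using B(2)[OF U] by blast
    \<comment> \<open>On \<open>K\<close>, avoiding the closed set \<open>Q n\<close> amounts to
      lying in the preimage of \<open>B n\<close>, so that preimage is relatively open.\<close>
    have "open (\<Union>n\<in>J. - Q n)"
      using Q(2) by (intro open_UN ballI open_Compl compact_imp_closed) auto
    moreover have "(\<Union>n\<in>J. - Q n) \<inter> K = g -` U \<inter> K"
    proof -
      have "x \<notin> Q n \<longleftrightarrow> g x \<in> B n" if "x \<in> K" for x n
        using that P(1)[of n] Q(1)[of n] unfolding K_def by blast
      then show ?thesis unfolding UJ by auto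
    qed
    ultimately show "\<exists>A. open A \<and> A \<inter> K = g -` U \<inter> K" by blast
  qed
  moreover have "measure M (X - K) \<le> e"
  proof -
    define E where "E n = X - (P n \<union> Q n)" for n
    have [measurable]: "P n \<in> sets M" "Q n \<in> sets M" "X \<in> sets M" "g -` B n \<in> sets M" for n
      using P(2) Q(2) X pre[OF B(1)] M(2) by (auto intro: borel_compact)
    have E: "measure M (E n) \<le> e * (1/2) ^ Suc n" for n
    proof -
      have "measure M (E n) \<le> measure M ((X \<inter> g -` B n - P n) \<union> (X - g -` B n - Q n))"
        by (rule finite_measure_mono) (auto simp: E_def)
      also have "\<dots> \<le> measure M (X \<inter> g -` B n - P n) + measure M (X - g -` B n - Q n)"
        by (rule measure_Un_le) auto
      also have "\<dots> \<le> d n + d n" using P(3)[of n] Q(3)[of n] by simp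
      finally show ?thesis by (simp add: d_def)
    qed
    have s: "(\<lambda>n. e * (1/2) ^ Suc n) sums e"
      using sums_mult[OF power_half_series, of e] by simp
    have "summable (\<lambda>n. measure M (E n))"
      by (rule summable_comparison_test'[OF sums_summable[OF s], of 0]) (use E in auto)
    moreover have "X - K = (\<Union>n. E n)" by (auto simp: K_def E_def)
    ultimately have "measure M (X - K) \<le> (\<Sum>n. measure M (E n))"
      by (simp, intro finite_measure_subadditive_countably) (auto simp: E_def)
    also have "\<dots> \<le> e"
      using suminf_le[OF E \<open>summable (\<lambda>n. measure M (E n))\<close> sums_summable[OF s]] s
      by (simp add: sums_iff)
    finally show ?thesis .
  qed
  ultimately show thesis by (rule that)
qed

text \<open>
  A substitute for the Lusin--Souslin theorem: up to a null set, the domain is a countable union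
  of compact sets on which \<open>g\<close> is continuous, and \<open>g\<close> maps their closed subsets to compact sets.
\<close>

lemma ex_borel_left_inverse_AE:
  fixes M :: "'a::polish_space measure" and g :: "'a \<Rightarrow> 'b::{second_countable_topology, t2_space}"
  assumes M: "finite_measure M" "sets M = sets borel" and X: "X \<in> sets borel"
    and g: "g \<in> borel_measurable borel" and inj: "inj_on g X" and x0: "x0 \<in> X"
  obtains X' h where "X' \<in> sets borel" "X' \<subseteq> X" "emeasure M (X - X') = 0" "g ` X' \<in> sets borel"
    "h \<in> borel_measurable borel" "range h \<subseteq> X" "\<And>x. x \<in> X' \<Longrightarrow> h (g x) = x"
proof -
  interpret finite_measure M by fact
  have "\<forall>n::nat. \<exists>K. K \<subseteq> X \<and> compact K \<and> continuous_on K g \<and> measure M (X - K) \<le> 1 / Suc n"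
  proof
    fix n :: nat
    show "\<exists>K. K \<subseteq> X \<and> compact K \<and> continuous_on K g \<and> measure M (X - K) \<le> 1 / Suc n"
      by (rule lusin_compact[OF M X g, of "1 / Suc n"]) auto
  qed
  from choice[OF this] obtain K where K: "\<And>n::nat. K n \<subseteq> X" "\<And>n. compact (K n)"
    "\<And>n. continuous_on (K n) g" "\<And>n. measure M (X - K n) \<le> 1 / Suc n" by blast
  \<comment> \<open>Each \<open>K n\<close> misses mass at most \<open>1 / Suc n\<close>, so the
    union exhausts \<open>X\<close> up to a null set.\<close>
  define X' where "X' = (\<Union>n. K n)"
  have KB: "K n \<in> sets borel" for n using K(2) by (rule borel_compact)
  have X'X: "X' \<subseteq> X" using K(1) by (auto simp: X'_def)
  have img: "g ` (C \<inter> X') \<in> sets borel" if "closed C" for C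
  proof -
    have "compact (g ` (C \<inter> K n))" for n
      using that K(2,3)[of n]
      by (intro compact_continuous_image) (auto intro: continuous_on_subset closed_Int_compact)
    then have "(\<Union>n. g ` (C \<inter> K n)) \<in> sets borel"
      by (intro sets.countable_UN) (auto intro: borel_compact)
    also have "(\<Union>n. g ` (C \<inter> K n)) = g ` (C \<inter> X')" by (auto simp: X'_def)
    finally show ?thesis .
  qed
  \<comment> \<open>The default \<open>x0\<close> keeps the range of \<open>h\<close> inside
    \<open>X\<close>.\<close>
  define h where "h y = (if y \<in> g ` X' then inv_into X' g y else x0)" for y
  have hg: "h (g x) = x" if "x \<in> X'" for x
    using that inj_on_subset[OF inj X'X] by (simp add: h_def)
  have closed: "h -` C \<in> sets borel" if C: "closed C" for C
  proof -
    have "h -` C = g ` (C \<inter> X') \<union> (if x0 \<in> C then - (g ` X') else {})"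
      using hg by (auto simp: h_def split: if_splits)
    moreover have "\<dots> \<in> sets borel"
      using img[OF C] img[OF closed_UNIV] by auto
    ultimately show ?thesis by simp
  qed
  have "h \<in> borel_measurable borel"
  proof (rule borel_measurableI)
    fix U :: "'a set" assume "open U"
    then have "- (h -` (- U)) \<in> sets borel" using closed[of "- U"] by (auto simp: closed_Compl)
    then show "h -` U \<inter> space borel \<in> sets borel" by (simp add: vimage_Compl)
  qed
  moreover have "range h \<subseteq> X"
    using x0 X'X by (auto simp: h_def intro: inv_into_into[THEN subsetD[OF X'X]])
  moreover have "emeasure M (X - X') = 0"
  proof -
    have [measurable]: "X \<in> sets M" "K n \<in> sets M" for n using X KB M(2) by auto
    have "measure M (X - X') \<le> 1 / Suc n" for n
    proof -
      have "measure M (X - X') \<le> measure M (X - K n)"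
        by (rule finite_measure_mono) (auto simp: X'_def)
      then show ?thesis using K(4)[of n] by linarith
    qed
    then have "measure M (X - X') \<le> 0"
      using LIMSEQ_le_const[OF LIMSEQ_inverse_real_of_nat, of "measure M (X - X')"]
      by (auto simp: inverse_eq_divide)
    then show ?thesis by (simp add: emeasure_eq_measure measure_le_0_iff)
  qed
  moreover have "X' \<in> sets borel" using KB by (auto simp: X'_def)
  ultimately show thesis using that[of X' h] img[OF closed_UNIV] hg X'X by auto
qed

section \<open>Isomorphism of diffuse measures\<close>

text \<open>A diffuse measure has a continuous cdf, and the cdf as a random variable is uniform on
  the interval from 0 to the total mass. The right-hand side is the upper tail of that law, for
  every real \<open>t\<close>.\<close>

lemma (in finite_borel_measure) measure_cdf_greater:
  assumes diffuse: "\<And>x. measure M {x} = 0"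
  shows "measure M {x. t < cdf M x} = measure M (space M) - max 0 (min (measure M (space M)) t)"
proof -
  let ?a = "measure M (space M)" and ?S = "{x. cdf M x \<le> t}"
  have space: "space M = UNIV" by (rule borel_UNIV)
  have cont: "continuous_on A (cdf M)" for A
    using diffuse isCont_cdf by (auto intro: continuous_at_imp_continuous_on)
  consider "t < 0" | "?a \<le> t" | "0 \<le> t" "t < ?a" by linarith
  then show ?thesis
  proof cases
    case 1
    then have "{x. t < cdf M x} = space M"
      using cdf_nonneg less_le_trans by (fastforce simp: space)
    then show ?thesis using 1 by simp
  next
    case 2
    then have "{x. t < cdf M x} = {}"
      using order_trans[OF cdf_bounded 2] by (auto simp: not_less)
    then show ?thesis using 2 by simp
  next
    case 3
    have "\<forall>\<^sub>F x in at_top. t < cdf M x"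
      using cdf_lim_at_top 3(2) by (rule order_tendstoD)
    then obtain b where b: "t < cdf M b"
      by (auto dest: eventually_happens)
    have S_b: "x < b" if "x \<in> ?S" for x
      using that b cdf_nondecreasing[of b x] by force
    have "measure M ?S = t"
    proof (cases "?S = {}")
      case True
      have "t = 0"
      proof (rule ccontr)
        assume "t \<noteq> 0"
        then have "\<forall>\<^sub>F x in at_bot. cdf M x < t"
          using 3(1) by (intro order_tendstoD[OF cdf_lim_at_bot]) auto
        then obtain x where "cdf M x < t" by (auto dest: eventually_happens)
        then show False using True by (auto dest: less_imp_le)
      qed
      then show ?thesis using True by simp
    next
      case False
      have "closed ?S"
        using cont[of UNIV] by (intro closed_Collect_le) auto
      moreover have bdd: "bdd_above ?S" using S_b by (intro bdd_aboveI[of _ b]) force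
      ultimately have Sup: "Sup ?S \<in> ?S" using False by (intro closed_contains_Sup) auto
      \<comment> \<open>The intermediate value theorem gives a point at or beyond the supremum with
        value exactly \<open>t\<close>; maximality makes it the supremum, and \<open>?S\<close> is a
        half-line of mass \<open>t\<close>.\<close>
      have "\<exists>y\<ge>Sup ?S. y \<le> b \<and> cdf M y = t"
        using Sup b S_b[OF Sup] cont by (intro IVT') auto
      then obtain y where y: "Sup ?S \<le> y" "cdf M y = t" by blast
      then have "y = Sup ?S" using cSup_upper[OF _ bdd, of y] by force
      then have "cdf M (Sup ?S) = t" using y by simp
      moreover have "?S = {..Sup ?S}"
        using cSup_upper[OF _ bdd] Sup cdf_nondecreasing by (auto intro: order_trans)
      ultimately show ?thesis by (simp add: cdf_def)
    qed
    moreover have "?S \<in> sets M"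
      using cont[of UNIV] by (intro sets_M borel_closed closed_Collect_le) auto
    moreover have "{x. t < cdf M x} = space M - ?S" by (auto simp: space)
    ultimately show ?thesis using 3 by (simp add: finite_measure_compl)
  qed
qed

text \<open>Compose a Borel injection into the reals with the cdf of the image measure. Injectivity
  fails only on flat stretches of the cdf; each contains a rational, so removing countably many null
  level sets restores it.\<close>

lemma ex_uniformizing_map:
  fixes M :: "'a::polish_space measure"
  assumes M: "finite_measure M" "sets M = sets borel" and diffuse: "\<And>x. measure M {x} = 0"
  obtains f :: "'a \<Rightarrow> real" and Z where "f \<in> borel_measurable borel" "Z \<in> sets borel"
    "emeasure M (- Z) = 0" "inj_on f Z"
    "\<And>t. measure M {x. t < f x} = measure M UNIV - max 0 (min (measure M UNIV) t)"
proof -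
  interpret finite_measure M by fact
  have space: "space M = UNIV" using sets_eq_imp_space_eq[OF M(2)] by simp
  obtain e :: "'a \<Rightarrow> real" where e[measurable]: "e \<in> borel_measurable borel" and "inj e"
    using ex_borel_injection_real by blast
  have eM: "e \<in> borel_measurable M" using e M(2) by (simp cong: measurable_cong_sets)
  define D where "D = distr M borel e"
  interpret D: finite_measure D unfolding D_def by (rule finite_measure_distr[OF eM])
  interpret D: finite_borel_measure D by standard (simp add: D_def)
  have D: "measure D A = measure M (e -` A)" if "A \<in> sets borel" for A
    using that eM by (simp add: D_def measure_distr space)
  have diffuse_D: "measure D {y} = 0" for y
  proof -
    have "e -` {y} = {} \<or> (\<exists>x. e -` {y} = {x})"
      using \<open>inj e\<close> by (auto simp: inj_def) blast
    then show ?thesis using diffuse by (auto simp: D)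
  qed
  define F where "F = cdf D"
  have F_mono: "F x \<le> F y" if "x \<le> y" for x y using D.cdf_nondecreasing[OF that] by (simp add: F_def)
  have [measurable]: "F \<in> borel_measurable borel"
    using F_mono by (intro borel_measurable_mono) (auto simp: mono_def)
  have F_gt: "measure D {x. t < F x} = measure M UNIV - max 0 (min (measure M UNIV) t)" for t
    using D.measure_cdf_greater[OF diffuse_D] D[of UNIV] by (simp add: F_def D_def)
  have F_eq: "measure D {x. F x = s} = 0" for s
  proof -
    \<comment> \<open>The level set lies where \<open>F\<close> takes values above
      \<open>s - d\<close> and at most \<open>s\<close>, a set of mass at most \<open>d\<close> by
      uniformity.\<close>
    have "measure D {x. F x = s} \<le> 0 + d" if "0 < d" for d
    proof -
      have "measure D {x. F x = s} \<le> measure D ({x. s - d < F x} - {x. s < F x})"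
        using that by (intro D.finite_measure_mono) (auto simp: D_def)
      also have "\<dots> = measure D {x. s - d < F x} - measure D {x. s < F x}"
        using that by (intro D.finite_measure_Diff) (auto simp: D_def)
      also have "\<dots> \<le> 0 + d" using that by (simp add: F_gt)
      finally show ?thesis .
    qed
    then show ?thesis by (metis field_le_epsilon measure_le_0_iff)
  qed
  define W where "W = (\<Union>q\<in>\<rat>. {x. F x = F q})"
  have [measurable]: "W \<in> sets borel"
    unfolding W_def by (intro sets.countable_UN' countable_rat) auto
  have "W \<in> null_sets D"
    unfolding W_def
    by (intro null_sets_UN' countable_rat) (auto simp: null_sets_def D_def[THEN arg_cong[of _ _ sets]] D.emeasure_eq_measure F_eq)
  then have "emeasure M (e -` W) = 0"
    using eM by (simp add: D_def null_sets_def emeasure_distr space)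
  moreover have "inj_on (\<lambda>x. F (e x)) (- (e -` W))"
  proof -
    have "a \<in> W" if "a < b" "F a = F b" for a b
    proof -
      obtain q where "q \<in> \<rat>" "a < q" "q < b" using Rats_dense_in_real \<open>a < b\<close> by blast
      then have "F a = F q" using F_mono[of a q] F_mono[of q b] that(2) by simp
      then show ?thesis using \<open>q \<in> \<rat>\<close> by (auto simp: W_def)
    qed
    then show ?thesis using \<open>inj e\<close>
      by (auto simp: inj_on_def) (metis injD linorder_neqE_linordered_idom)
  qed
  moreover have "measure M {x. t < F (e x)} = measure M UNIV - max 0 (min (measure M UNIV) t)" for t
    using F_gt[of t] by (simp add: D vimage_def)
  moreover have "- (e -` W) \<in> sets borel"
    using measurable_sets[OF e, of W] by (auto simp: Compl_eq_Diff_UNIV)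
  ultimately show thesis
    by (intro that[of "\<lambda>x. F (e x)" "- (e -` W)"]) auto
qed

text \<open>Both measures have the same uniform law on a real interval; the uniformizing map of
  \<open>M\<close> is followed by an almost everywhere left inverse of that of
  \<open>N\<close>.\<close>

lemma diffuse_isomorphism:
  fixes M :: "'a::polish_space measure" and N :: "'b::polish_space measure"
  assumes M: "finite_measure M" "sets M = sets borel" "\<And>x. measure M {x} = 0"
    and N: "finite_measure N" "sets N = sets borel" "\<And>x. measure N {x} = 0"
    and eq: "measure M UNIV = measure N UNIV"
  obtains g D where "g \<in> borel \<rightarrow>\<^sub>M borel" "D \<in> sets borel" "emeasure M (- D) = 0" "inj_on g D"
    "distr M borel g = N"
proof -
  interpret M: finite_measure M by fact
  interpret N: finite_measure N by fact
  have space: "space M = UNIV" "space N = UNIV"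
    using sets_eq_imp_space_eq[OF M(2)] sets_eq_imp_space_eq[OF N(2)] by simp_all
  have meas: "f \<in> borel \<rightarrow>\<^sub>M L \<Longrightarrow> f \<in> M \<rightarrow>\<^sub>M L" "k \<in> borel \<rightarrow>\<^sub>M L \<Longrightarrow> k \<in> N \<rightarrow>\<^sub>M L" for f k L
    using M(2) N(2) by (simp_all cong: measurable_cong_sets)
  obtain f Z where f: "f \<in> borel_measurable borel" "Z \<in> sets borel" "emeasure M (- Z) = 0" "inj_on f Z"
    "\<And>t. measure M {x. t < f x} = measure M UNIV - max 0 (min (measure M UNIV) t)"
    using ex_uniformizing_map[OF M] by blast
  obtain k Y where k: "k \<in> borel_measurable borel" "Y \<in> sets borel" "emeasure N (- Y) = 0" "inj_on k Y"
    "\<And>t. measure N {x. t < k x} = measure N UNIV - max 0 (min (measure N UNIV) t)"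
    using ex_uniformizing_map[OF N] by blast
  have fk: "distr M borel f = distr N borel k"
  proof (rule measure_eqI_lessThan)
    fix t :: real
    have "emeasure (distr M borel f) {t<..} = emeasure M {x. t < f x}"
      using meas(1)[OF f(1)] by (simp add: emeasure_distr space vimage_def)
    moreover have "emeasure (distr N borel k) {t<..} = emeasure N {x. t < k x}"
      using meas(2)[OF k(1)] by (simp add: emeasure_distr space vimage_def)
    ultimately show "emeasure (distr M borel f) {t<..} = emeasure (distr N borel k) {t<..}"
      "emeasure (distr M borel f) {t<..} < \<infinity>"
      by (simp_all add: M.emeasure_eq_measure N.emeasure_eq_measure f(5) k(5) eq)
  qed simp_all
  show thesis
  \<comment> \<open>The left inverse needs a default point in \<open>Y\<close>; without one, both
    measures are zero and a constant map serves.\<close>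
  proof (cases "Y = {}")
    case True
    then have N0: "emeasure N UNIV = 0" using k(3) by simp
    then have M0: "emeasure M UNIV = 0"
      using eq by (simp add: M.emeasure_eq_measure N.emeasure_eq_measure)
    have "distr M borel (\<lambda>_. undefined) = N"
    proof (rule measure_eqI)
      fix A assume "A \<in> sets (distr M borel (\<lambda>_. undefined :: 'b))"
      have "emeasure N A \<le> emeasure N UNIV" "emeasure (distr M borel (\<lambda>_. undefined)) A \<le> emeasure M UNIV"
        using emeasure_space[of N A] emeasure_space[of "distr M borel (\<lambda>_. undefined)" A]
        by (simp_all add: space emeasure_distr)
      then show "emeasure (distr M borel (\<lambda>_. undefined)) A = emeasure N A"
        using M0 N0 by simp
    qed (simp add: N)
    then show thesis using that[of "\<lambda>_. undefined" "{}"] M0 by simp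
  next
    case False
    then obtain y0 where "y0 \<in> Y" by blast
    obtain Y' h where h: "Y' \<in> sets borel" "Y' \<subseteq> Y" "emeasure N (Y - Y') = 0" "k ` Y' \<in> sets borel"
      "h \<in> borel_measurable borel" "\<And>x. x \<in> Y' \<Longrightarrow> h (k x) = x"
      using ex_borel_left_inverse_AE[OF N(1,2) k(2,1,4) \<open>y0 \<in> Y\<close>] by metis
    have hk: "(\<lambda>x. h (k x)) \<in> borel_measurable borel" and hf: "(\<lambda>x. h (f x)) \<in> borel_measurable borel"
      using h(5) k(1) f(1) by measurable
    have "Y - Y' \<in> null_sets N" "- Y \<in> null_sets N"
      using h k N(2) by (auto intro!: null_setsI)
    then have Y': "- Y' \<in> null_sets N"
    proof -
      have "Y - Y' \<union> - Y = - Y'" using h(2) by blast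
      then show ?thesis using null_sets.Un[of "Y - Y'" N "- Y"] \<open>Y - Y' \<in> null_sets N\<close> \<open>- Y \<in> null_sets N\<close>
        by simp
    qed
    have "AE x in N. h (k x) = x"
      using Y' h(6) by (intro AE_I'[of "- Y'"]) auto
    then have "distr N borel (\<lambda>x. h (k x)) = distr N borel (\<lambda>x. x)"
      using meas(2)[OF hk] meas(2)[OF measurable_ident] by (intro distr_cong_AE) (auto simp: id_def)
    also have "\<dots> = N" using N(2) by (simp add: distr_id2)
    also have "distr N borel (\<lambda>x. h (k x)) = distr (distr N borel k) borel h"
      using meas(2)[OF k(1)] h(5) by (subst distr_distr) (auto simp: comp_def)
    also have "\<dots> = distr M borel (\<lambda>x. h (f x))"
      using meas(1)[OF f(1)] h(5) unfolding fk[symmetric] by (subst distr_distr) (auto simp: comp_def)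
    finally have distr: "distr M borel (\<lambda>x. h (f x)) = N" .
    \<comment> \<open>As \<open>f\<close> and \<open>k\<close> have the same law, \<open>f\<close>
      lands almost everywhere in the image of \<open>Y'\<close> under \<open>k\<close>, and there
      \<open>h\<close> is injective.\<close>
    have pre: "f -` (k ` Y') \<in> sets borel" using measurable_sets[OF f(1) h(4)] by simp
    have "emeasure M (- (f -` (k ` Y'))) = emeasure (distr M borel f) (- (k ` Y'))"
      using meas(1)[OF f(1)] h(4) by (simp add: emeasure_distr space vimage_Compl)
    also have "\<dots> = emeasure N (- (k -` (k ` Y')))"
      unfolding fk using meas(2)[OF k(1)] h(4) by (simp add: emeasure_distr space vimage_Compl)
    also have "\<dots> \<le> emeasure N (- Y')"
      using h(1) N(2) by (intro emeasure_mono) auto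
    also have "\<dots> = 0" using Y' by auto
    finally have "emeasure M (- (f -` (k ` Y'))) = 0" by simp
    moreover have "- (f -` (k ` Y')) \<in> sets M"
      using sets.Diff[OF sets.top pre] M(2) by (simp add: Compl_eq_Diff_UNIV)
    ultimately have "- (f -` (k ` Y')) \<in> null_sets M" by (rule null_setsI)
    moreover have "- Z \<in> null_sets M" using f M(2) by (auto intro!: null_setsI)
    ultimately have "- Z \<union> - (f -` (k ` Y')) \<in> null_sets M" by auto
    then have "emeasure M (- (Z \<inter> f -` (k ` Y'))) = 0" by (simp add: null_sets_def)
    moreover have "inj_on (\<lambda>x. h (f x)) (Z \<inter> f -` (k ` Y'))"
      using f(4) h(6) by (fastforce simp: inj_on_def)
    ultimately show thesis
      using that[of "\<lambda>x. h (f x)" "Z \<inter> f -` (k ` Y')"] hf distr f(2) pre by blast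
  qed
qed

section \<open>Gluing and atoms\<close>

text \<open>\<open>i\<close> and \<open>j\<close> label matching partitions. Injectivity across
  pieces holds because on \<open>D\<close> the image of a point keeps its label.\<close>

lemma glue_piecewise_isomorphisms:
  fixes M :: "'a::polish_space measure" and N :: "'b::polish_space measure"
    and i :: "'a \<Rightarrow> nat" and j :: "'b \<Rightarrow> nat"
  assumes M: "sets M = sets borel" and N: "sets N = sets borel"
    and i: "i \<in> borel \<rightarrow>\<^sub>M count_space UNIV" and j: "j \<in> borel \<rightarrow>\<^sub>M count_space UNIV"
    and pieces: "\<And>n. \<exists>g D. g \<in> borel \<rightarrow>\<^sub>M borel \<and> D \<in> sets borel \<and> emeasure M (i -` {n} - D) = 0 \<and>
      inj_on g D \<and> (\<forall>A\<in>sets borel. emeasure M (i -` {n} \<inter> g -` A) = emeasure N (j -` {n} \<inter> A))"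
  obtains g D where "g \<in> borel \<rightarrow>\<^sub>M borel" "D \<in> sets borel" "emeasure M (- D) = 0" "inj_on g D"
    "distr M borel g = N" "\<And>x. x \<in> D \<Longrightarrow> j (g x) = i x"
proof -
  have space: "space M = UNIV" "space N = UNIV"
    using sets_eq_imp_space_eq[OF M] sets_eq_imp_space_eq[OF N] by simp_all
  from pieces have "\<forall>n. \<exists>gD. fst gD \<in> borel \<rightarrow>\<^sub>M borel \<and> snd gD \<in> sets borel \<and>
      emeasure M (i -` {n} - snd gD) = 0 \<and> inj_on (fst gD) (snd gD) \<and>
      (\<forall>A\<in>sets borel. emeasure M (i -` {n} \<inter> fst gD -` A) = emeasure N (j -` {n} \<inter> A))"
    by simp
  from choice[OF this] obtain gD where gD: "\<And>n. fst (gD n) \<in> borel \<rightarrow>\<^sub>M borel"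
    "\<And>n. snd (gD n) \<in> sets borel" "\<And>n. emeasure M (i -` {n} - snd (gD n)) = 0"
    "\<And>n. inj_on (fst (gD n)) (snd (gD n))"
    "\<And>n A. A \<in> sets borel \<Longrightarrow>
      emeasure M (i -` {n} \<inter> fst (gD n) -` A) = emeasure N (j -` {n} \<inter> A)"
    by blast
  define g where "g x = fst (gD (i x)) x" for x
  have g: "g \<in> borel \<rightarrow>\<^sub>M borel"
    unfolding g_def using gD(1) i by (rule measurable_compose_countable)
  then have gM: "g \<in> M \<rightarrow>\<^sub>M borel" using M by (simp cong: measurable_cong_sets)
  have iB: "i -` {n} \<in> sets borel" for n using measurable_sets[OF i, of "{n}"] by simp
  have jB: "j -` {n} \<in> sets borel" for n using measurable_sets[OF j, of "{n}"] by simp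
  have gB: "g -` A \<in> sets borel" if "A \<in> sets borel" for A using measurable_sets[OF g that] by simp
  \<comment> \<open>Points whose image leaves the piece of the same label are discarded too; the
    transport identity for the complement of that piece shows that they are null.\<close>
  define E where "E n = i -` {n} \<inter> snd (gD n) \<inter> g -` (j -` {n})" for n
  define D where "D = (\<Union>n. E n)"
  have E: "E n \<in> sets borel" for n
    unfolding E_def using iB gD(2) gB[OF jB] by blast
  then have D: "D \<in> sets borel" by (auto simp: D_def)
  have local: "i -` {n} \<inter> g -` A = i -` {n} \<inter> fst (gD n) -` A" for n A by (auto simp: g_def)
  have "emeasure M (i -` {n} - E n) = 0" for n
  proof -
    have "- (j -` {n}) \<in> sets borel" using jB by (simp add: borel_comp)
    have "i -` {n} \<inter> g -` (- (j -` {n})) \<in> sets M"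
      using iB gB[OF \<open>- (j -` {n}) \<in> sets borel\<close>] M by simp
    then have "i -` {n} \<inter> g -` (- (j -` {n})) \<in> null_sets M"
      using gD(5)[OF \<open>- (j -` {n}) \<in> sets borel\<close>, of n] by (auto simp: local null_sets_def)
    moreover have "i -` {n} - snd (gD n) \<in> null_sets M"
      using gD(2,3) iB M by (auto simp: null_sets_def)
    ultimately have "(i -` {n} - snd (gD n)) \<union> (i -` {n} \<inter> g -` (- (j -` {n}))) \<in> null_sets M"
      by (rule null_sets.Un[rotated])
    moreover have "i -` {n} - E n = (i -` {n} - snd (gD n)) \<union> (i -` {n} \<inter> g -` (- (j -` {n})))"
      by (auto simp: E_def)
    ultimately show ?thesis by (simp add: null_sets_def)
  qed
  then have "emeasure M (\<Union>n. i -` {n} - E n) = 0"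
    using iB E M by (intro emeasure_UN_eq_0) auto
  moreover have "(\<Union>n. i -` {n} - E n) = - D"
    by (auto simp: D_def E_def)
  moreover have "inj_on g D"
  proof
    fix x y assume *: "x \<in> D" "y \<in> D" "g x = g y"
    then have "i x = i y" by (auto simp: D_def E_def)
    moreover have "x \<in> snd (gD (i x))" "y \<in> snd (gD (i y))" using * by (auto simp: D_def E_def)
    ultimately show "x = y" using gD(4)[of "i x"] *(3) by (auto simp: g_def inj_on_def)
  qed
  moreover have "distr M borel g = N"
  proof (rule measure_eqI)
    fix A assume "A \<in> sets (distr M borel g)"
    then have A: "A \<in> sets borel" by simp
    have "emeasure (distr M borel g) A = emeasure M (g -` A)"
      using gM A by (simp add: emeasure_distr space)
    also have "g -` A = (\<Union>n. i -` {n} \<inter> g -` A)" by auto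
    also have "emeasure M \<dots> = (\<Sum>n. emeasure M (i -` {n} \<inter> g -` A))"
      using iB gB[OF A] M by (intro suminf_emeasure[symmetric]) (auto simp: disjoint_family_on_def)
    also have "\<dots> = (\<Sum>n. emeasure N (j -` {n} \<inter> A))"
      using gD(5)[OF A] by (simp add: local)
    also have "\<dots> = emeasure N (\<Union>n. j -` {n} \<inter> A)"
      using jB A N by (intro suminf_emeasure) (auto simp: disjoint_family_on_def)
    also have "(\<Union>n. j -` {n} \<inter> A) = A" by auto
    finally show "emeasure (distr M borel g) A = emeasure N A" .
  qed (simp add: N)
  moreover have "j (g x) = i x" if "x \<in> D" for x
    using that by (auto simp: D_def E_def)
  ultimately show thesis using that[of g D] g D by simp
qed

text \<open>An indicator density restricts each measure to its piece but keeps it on the whole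
  Polish type, where \<open>diffuse_isomorphism\<close> applies.\<close>

lemma isomorphism_on_diffuse_piece:
  fixes M :: "'a::polish_space measure" and N :: "'b::polish_space measure"
  assumes M: "finite_measure M" "sets M = sets borel" and N: "finite_measure N" "sets N = sets borel"
    and A: "A \<in> sets borel" and B: "B \<in> sets borel" and eq: "emeasure M A = emeasure N B"
    and "\<And>x. x \<in> A \<Longrightarrow> emeasure M {x} = 0" "\<And>x. x \<in> B \<Longrightarrow> emeasure N {x} = 0"
  shows "\<exists>g D. g \<in> borel \<rightarrow>\<^sub>M borel \<and> D \<in> sets borel \<and> emeasure M (A - D) = 0 \<and>
      inj_on g D \<and> (\<forall>X\<in>sets borel. emeasure M (A \<inter> g -` X) = emeasure N (B \<inter> X))"
proof -
  interpret M: finite_measure M by fact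
  interpret N: finite_measure N by fact
  define M' where "M' = density M (indicator A)"
  define N' where "N' = density N (indicator B)"
  have M': "emeasure M' X = emeasure M (A \<inter> X)" if "X \<in> sets borel" for X
    unfolding M'_def using that A M(2) by (intro emeasure_restricted) auto
  have N': "emeasure N' X = emeasure N (B \<inter> X)" if "X \<in> sets borel" for X
    unfolding N'_def using that B N(2) by (intro emeasure_restricted) auto
  have fin: "finite_measure M'" "finite_measure N'"
    unfolding M'_def N'_def using A B M N
    by (simp_all add: M.finite_measure_restricted N.finite_measure_restricted)
  have sets: "sets M' = sets borel" "sets N' = sets borel" by (simp_all add: M'_def N'_def M N)
  have M0: "measure M' {x} = 0" for x
    using assms(8)[of x] by (cases "x \<in> A") (auto simp: M' measure_def)
  have N0: "measure N' {x} = 0" for x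
    using assms(9)[of x] by (cases "x \<in> B") (auto simp: N' measure_def)
  have "measure M' UNIV = measure N' UNIV" by (simp add: measure_def M' N' eq)
  then obtain g D where g: "g \<in> borel \<rightarrow>\<^sub>M borel" "D \<in> sets borel" "emeasure M' (- D) = 0"
    "inj_on g D" "distr M' borel g = N'"
    by (rule diffuse_isomorphism[OF fin(1) sets(1) M0 fin(2) sets(2) N0])
  have "emeasure M (A \<inter> g -` X) = emeasure N (B \<inter> X)" if X: "X \<in> sets borel" for X
  proof -
    have "g \<in> M' \<rightarrow>\<^sub>M borel" using g(1) sets by (simp cong: measurable_cong_sets)
    then have "emeasure (distr M' borel g) X = emeasure M' (g -` X)"
      using X sets_eq_imp_space_eq[OF sets(1)] by (simp add: emeasure_distr)
    then show ?thesis
      using measurable_sets[OF g(1) X] X by (simp add: g(5) M' N')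
  qed
  moreover have "emeasure M (A - D) = 0"
    using g(2,3) M'[of "- D"] by (simp add: borel_comp Diff_eq)
  ultimately show ?thesis using g by blast
qed

text \<open>The whole mass of \<open>B\<close> sits at \<open>y\<close>, so a constant map
  transports the atom, and it is injective on a single point.\<close>

lemma isomorphism_on_atomic_piece:
  fixes M :: "'a::polish_space measure" and N :: "'b::polish_space measure"
  assumes N: "finite_measure N" "sets N = sets borel" and B: "B \<in> sets borel" and y: "y \<in> B"
    and eq: "emeasure M {x} = emeasure N B" "emeasure N {y} = emeasure N B"
  shows "\<exists>g D. g \<in> borel \<rightarrow>\<^sub>M borel \<and> D \<in> sets borel \<and> emeasure M ({x} - D) = 0 \<and>
      inj_on g D \<and> (\<forall>X\<in>sets borel. emeasure M ({x} \<inter> g -` X) = emeasure N (B \<inter> X))"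
proof (intro exI[of _ "\<lambda>_. y"] exI[of _ "{x}"] conjI ballI)
  interpret N: finite_measure N by fact
  fix X :: "'b set" assume X: "X \<in> sets borel"
  show "emeasure M ({x} \<inter> (\<lambda>_. y) -` X) = emeasure N (B \<inter> X)"
  proof (cases "y \<in> X")
    case True
    have "emeasure N {y} \<le> emeasure N (B \<inter> X)" "emeasure N (B \<inter> X) \<le> emeasure N B"
      using True y B X N(2) by (auto intro!: emeasure_mono)
    then show ?thesis using True eq by simp
  next
    case False
    have "emeasure N (B \<inter> X) \<le> emeasure N (B - {y})"
      using False B N(2) by (intro emeasure_mono) auto
    also have "\<dots> = emeasure N B - emeasure N {y}"
      using y B N(2) by (intro emeasure_Diff) auto
    also have "\<dots> = 0" using eq by simp
    finally show ?thesis using False by simp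
  qed
qed (auto intro: measurable_const)

section \<open>The sum of squared atom masses\<close>

lemma measurable_emeasure_singleton:
  fixes M :: "'a::polish_space measure"
  assumes "finite_measure M" "sets M = sets borel"
  shows "(\<lambda>x. emeasure M {x}) \<in> borel_measurable borel"
proof -
  interpret finite_measure M by fact
  \<comment> \<open>A singleton is a section of the diagonal, which is closed, and the measure of a
    section depends measurably on the point.\<close>
  have "{(x :: 'a, y). x = y} \<in> sets (borel \<Otimes>\<^sub>M borel)"
    unfolding borel_prod by (intro borel_closed) (auto simp: case_prod_beta' intro!: closed_Collect_eq continuous_intros)
  then have "{(x :: 'a, y). x = y} \<in> sets (borel \<Otimes>\<^sub>M M)"
    using sets_pair_measure_cong[OF refl assms(2), of "borel :: 'a measure"] by simp
  from measurable_emeasure_Pair[OF this]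
  have "(\<lambda>x. emeasure M (Pair x -` {(x, y). x = y})) \<in> borel_measurable borel" .
  moreover have "Pair x -` {(x, y). x = y} = {x}" for x :: 'a by auto
  ultimately show ?thesis by simp
qed

text \<open>The fibres of an injective map are singletons, so point masses are kept. This compares
  atoms of measures linked through injective maps into a common space.\<close>

lemma nn_integral_emeasure_singleton_distr:
  fixes H :: "'t \<Rightarrow> 'a::polish_space"
  assumes M: "finite_measure M" and H: "H \<in> borel_measurable M" "inj_on H (space M)"
  shows "(\<integral>\<^sup>+x. emeasure (distr M borel H) {x} \<partial>distr M borel H) = (\<integral>\<^sup>+x. emeasure M {x} \<partial>M)"
proof -
  have "finite_measure (distr M borel H)" using M H(1) by (rule finite_measure.finite_measure_distr)
  then have "(\<integral>\<^sup>+x. emeasure (distr M borel H) {x} \<partial>distr M borel H)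
    = (\<integral>\<^sup>+x. emeasure (distr M borel H) {H x} \<partial>M)"
    using H(1) by (intro nn_integral_distr) (simp_all add: measurable_emeasure_singleton)
  also have "\<dots> = (\<integral>\<^sup>+x. emeasure M {x} \<partial>M)"
  proof (rule nn_integral_cong)
    fix x assume "x \<in> space M"
    then have "H -` {H x} \<inter> space M = {x}" using H(2) by (auto simp: inj_on_def)
    then show "emeasure (distr M borel H) {H x} = emeasure M {x}"
      using H(1) by (simp add: emeasure_distr)
  qed
  finally show ?thesis .
qed

text \<open>
  The number \<open>\<integral>\<^sup>+x. emeasure M {x} \<partial>M\<close> is the sum of the squared masses of the atoms. A pushforward
  that merges atoms, or absorbs diffuse mass into an atom, strictly increases it.
\<close>

lemma distr_preserves_atoms:
  fixes M :: "'a::polish_space measure" and h :: "'a \<Rightarrow> 'b::polish_space"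
  assumes M: "prob_space M" "sets M = sets borel" and h: "h \<in> borel \<rightarrow>\<^sub>M borel"
    and eq: "(\<integral>\<^sup>+x. emeasure M {x} \<partial>M)
      = (\<integral>\<^sup>+x. emeasure (distr M borel h) {x} \<partial>distr M borel h)"
  shows "AE x in M. emeasure M {x} = emeasure (distr M borel h) {h x}"
proof -
  interpret prob_space M by fact
  let ?P = "distr M borel h"
  have hM: "h \<in> M \<rightarrow>\<^sub>M borel" using h M(2) by (simp cong: measurable_cong_sets)
  have fin: "finite_measure ?P" using hM by (rule finite_measure_distr)
  have "(\<lambda>x. emeasure M {x}) \<in> borel_measurable borel"
    using M(2) by (intro measurable_emeasure_singleton) unfold_locales
  then have m1: "(\<lambda>x. emeasure M {x}) \<in> borel_measurable M" using M(2) by (simp cong: measurable_cong_sets)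
  have m: "(\<lambda>x. emeasure ?P {x}) \<in> borel_measurable borel"
    using fin by (intro measurable_emeasure_singleton) auto
  have m2: "(\<lambda>x. emeasure ?P {h x}) \<in> borel_measurable M"
    using measurable_compose[OF hM m] .
  have le: "emeasure M {x} \<le> emeasure ?P {h x}" for x
  proof -
    have "emeasure M {x} \<le> emeasure M (h -` {h x} \<inter> space M)"
      using measurable_sets[OF hM, of "{h x}"] sets_eq_imp_space_eq[OF M(2)]
      by (intro emeasure_mono) auto
    then show ?thesis using hM by (simp add: emeasure_distr)
  qed
  have eq2: "(\<integral>\<^sup>+x. emeasure ?P {h x} \<partial>M) = (\<integral>\<^sup>+x. emeasure M {x} \<partial>M)"
    unfolding eq using nn_integral_distr[OF hM, of "\<lambda>y. emeasure ?P {y}"] m by simp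
  \<comment> \<open>The bound by 1 makes the integral finite, so that it can be subtracted; the
    nonnegative difference of the integrands then has integral zero.\<close>
  have "(\<integral>\<^sup>+x. emeasure M {x} \<partial>M) \<le> (\<integral>\<^sup>+x. 1 \<partial>M)"
    by (intro nn_integral_mono emeasure_le_1)
  then have fin': "(\<integral>\<^sup>+x. emeasure M {x} \<partial>M) \<noteq> \<infinity>"
    by (auto simp: emeasure_space_1 top_unique)
  have "(\<integral>\<^sup>+x. (emeasure ?P {h x} - emeasure M {x}) \<partial>M)
      = (\<integral>\<^sup>+x. emeasure ?P {h x} \<partial>M) - (\<integral>\<^sup>+x. emeasure M {x} \<partial>M)"
    using m1 m2 fin' le by (intro nn_integral_diff) auto
  also have "\<dots> = 0" using fin' by (simp add: eq2)
  finally have "AE x in M. emeasure ?P {h x} - emeasure M {x} = 0"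
    using m1 m2 by (simp add: nn_integral_0_iff_AE)
  then show ?thesis
  proof eventually_elim
    case (elim x)
    have "emeasure ?P {h x} \<le> emeasure M {x}"
      using elim emeasure_finite[of "{x}"] by (simp add: ennreal_minus_eq_0)
    then show ?case using le[of x] by (rule antisym[rotated])
  qed
qed

section \<open>Injective couplings of small cost\<close>

text \<open>The partition pulled back along \<open>h\<close> has pieces of the same masses, and by
  \<open>atoms\<close> matching pieces are both diffuse or both carried by one atom. Gluing the
  piecewise isomorphisms gives \<open>G\<close> up to a null set.\<close>

lemma injective_coupling_along_partition:
  fixes P :: "'a::polish_space measure" and N :: "(real ^ 'm) measure" and h :: "real ^ 'm \<Rightarrow> 'a"
    and i :: "'a \<Rightarrow> nat"
  assumes P: "prob_space P" and N: "prob_space N" "sets N = sets borel"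
    and h: "h \<in> borel \<rightarrow>\<^sub>M borel" and P_eq: "distr N borel h = P"
    and atoms: "AE z in N. emeasure N {z} = emeasure P {h z}"
    and i: "i \<in> borel \<rightarrow>\<^sub>M count_space UNIV"
    and pieces: "\<And>n. (\<exists>x. i -` {n} = {x}) \<or> (\<forall>x\<in>i -` {n}. emeasure P {x} = 0)"
  obtains G where "G \<in> borel \<rightarrow>\<^sub>M borel" "inj G" "distr P borel G = N" "AE x in P. i (h (G x)) = i x"
proof -
  interpret P: prob_space P by fact
  interpret N: prob_space N by fact
  have sP: "sets P = sets borel" using P_eq by auto
  have fin: "finite_measure P" "finite_measure N" by unfold_locales
  have space: "space P = UNIV" "space N = UNIV"
    using sets_eq_imp_space_eq[OF sP] sets_eq_imp_space_eq[OF N(2)] by simp_all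
  have hN: "h \<in> N \<rightarrow>\<^sub>M borel" using h N(2) by (simp cong: measurable_cong_sets)
  have P: "emeasure P A = emeasure N (h -` A)" if "A \<in> sets borel" for A
    using hN that by (simp add: P_eq[symmetric] emeasure_distr space)
  have iB: "i -` {n} \<in> sets borel" for n using measurable_sets[OF i, of "{n}"] by simp
  have hB: "h -` A \<in> sets borel" if "A \<in> sets borel" for A using measurable_sets[OF h that] by simp
  define j where "j z = i (h z)" for z
  have j: "j \<in> borel \<rightarrow>\<^sub>M count_space UNIV" unfolding j_def using h i by (rule measurable_compose)
  have jB: "j -` {n} = h -` (i -` {n})" for n by (auto simp: j_def)
  have mass: "emeasure P (i -` {n}) = emeasure N (j -` {n})" for n
    unfolding jB by (rule P[OF iB])
  have pieces': "\<exists>g D. g \<in> borel \<rightarrow>\<^sub>M borel \<and> D \<in> sets borel \<and> emeasure P (i -` {n} - D) = 0 \<and>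
      inj_on g D \<and> (\<forall>A\<in>sets borel. emeasure P (i -` {n} \<inter> g -` A) = emeasure N (j -` {n} \<inter> A))"
    for n
  proof (cases "\<forall>x\<in>i -` {n}. emeasure P {x} = 0")
    case True
    have "emeasure N {z} = 0" if "z \<in> j -` {n}" for z
    proof -
      have "emeasure N {z} \<le> emeasure N (h -` {h z})"
        using hB[of "{h z}"] N(2) by (intro emeasure_mono) auto
      also have "\<dots> = 0" using True that P[of "{h z}"] by (simp add: j_def)
      finally show ?thesis by simp
    qed
    then show ?thesis
      using True iB hB[OF iB] mass sP N(2) fin
      by (intro isomorphism_on_diffuse_piece) (auto simp: jB)
  next
    case False
    then obtain x where x: "i -` {n} = {x}" using pieces[of n] by blast
    have "emeasure P {x} \<noteq> 0" using False unfolding x by simp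
    have pos: "emeasure N (j -` {n}) \<noteq> 0" using mass[of n] \<open>emeasure P {x} \<noteq> 0\<close> unfolding x by simp
    \<comment> \<open>The piece has positive mass, so the almost everywhere identity of atoms holds
      at one of its points, which then carries the mass of the whole piece.\<close>
    have "\<exists>z\<in>j -` {n}. emeasure N {z} = emeasure P {h z}"
    proof (rule ccontr)
      assume no: "\<not> ?thesis"
      have "AE z in N. z \<notin> j -` {n}" using atoms by eventually_elim (use no in auto)
      then have "emeasure N (j -` {n}) = 0"
        using hB[OF iB] N(2) by (subst (asm) AE_iff_measurable[of "j -` {n}"]) (auto simp: jB space)
      then show False using pos by simp
    qed
    then obtain z where z: "z \<in> j -` {n}" "emeasure N {z} = emeasure P {h z}" by blast
    have "h z = x" using z(1) x by (auto simp: jB)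
    then show ?thesis
      unfolding x using z hB[OF iB] hB[of "{x}"] mass[of n] x fin(2) N(2)
      by (intro isomorphism_on_atomic_piece[of N "j -` {n}" z]) (auto simp: jB)
  qed
  obtain g D where g: "g \<in> borel \<rightarrow>\<^sub>M borel" "D \<in> sets borel" "emeasure P (- D) = 0" "inj_on g D"
    "distr P borel g = N" "\<And>x. x \<in> D \<Longrightarrow> j (g x) = i x"
    by (rule glue_piecewise_isomorphisms[OF sP N(2) i j pieces']) blast
  obtain k :: "'a \<Rightarrow> real ^ 'm" and C where k: "k \<in> borel_measurable borel" "inj k" "range k \<subseteq> C"
    "C \<in> sets borel" "emeasure N C = 0"
    using ex_borel_injection_null_set[OF fin(2) N(2)] by blast
  have gP: "g \<in> P \<rightarrow>\<^sub>M borel" using g(1) sP by (simp cong: measurable_cong_sets)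
  \<comment> \<open>Removing the points that \<open>g\<close> sends into the null set
    \<open>C\<close> keeps the values of \<open>g\<close> on \<open>D'\<close> apart from those of
    \<open>k\<close>, which takes over elsewhere.\<close>
  define D' where "D' = D - g -` C"
  have gC: "g -` C \<in> sets borel" using measurable_sets[OF g(1) k(4)] by simp
  have D': "D' \<in> sets borel" using g(2) gC by (simp add: D'_def)
  define G where "G x = (if x \<in> D' then g x else k x)" for x
  have G: "G \<in> borel \<rightarrow>\<^sub>M borel"
    unfolding G_def using g(1) k(1) D' by (intro measurable_If_set) auto
  have "emeasure P (g -` C) = emeasure (distr P borel g) C"
    using gP k(4) by (simp add: emeasure_distr space)
  then have "g -` C \<in> null_sets P" using k(5) gC sP by (simp add: g(5) null_sets_def)
  moreover have "- D \<in> null_sets P" using g(2,3) sP by (auto simp: null_sets_def borel_comp)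
  ultimately have "- D \<union> g -` C \<in> null_sets P" by (rule null_sets.Un[rotated])
  then have ae: "AE x in P. x \<in> D'"
    by (rule AE_I') (auto simp: D'_def)
  have "distr P borel G = distr P borel g"
    using gP G sP ae by (intro distr_cong_AE) (auto simp: G_def cong: measurable_cong_sets elim: eventually_mono)
  then have "distr P borel G = N" using g(5) by simp
  moreover have "AE x in P. i (h (G x)) = i x"
    using ae by eventually_elim (use g(6) in \<open>auto simp: G_def D'_def j_def\<close>)
  moreover have "inj G"
  proof
    fix x y assume *: "G x = G y"
    have kC: "k u \<in> C" for u using k(3) by auto
    have gC: "g u \<notin> C" if "u \<in> D'" for u using that by (auto simp: D'_def)
    have "inj_on g D'" using g(4) by (rule inj_on_subset) (auto simp: D'_def)
    then show "x = y"
      using * k(2) kC[of x] kC[of y] gC[of x] gC[of y]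
      by (cases "x \<in> D'"; cases "y \<in> D'") (auto simp: G_def inj_on_def)
  qed
  ultimately show thesis using that[of G] G by blast
qed

text \<open>By continuity on the diagonal, where \<open>c\<close> vanishes, every point of
  \<open>X\<close> has a basic neighbourhood on which \<open>c\<close> stays below \<open>e\<close>.
  The least index of such a set is the label of a non-atom; each atom gets a label of its
  own.\<close>

lemma ex_small_partition_isolating_atoms:
  fixes P :: "'a::polish_space measure" and c :: "'a \<Rightarrow> 'a \<Rightarrow> real"
  assumes P: "finite_measure P" and c: "continuous_on (X \<times> X) (\<lambda>(x, y). c x y)"
    and c0: "\<And>x. x \<in> X \<Longrightarrow> c x x = 0" and e: "0 < e"
  obtains i :: "'a \<Rightarrow> nat" where "i \<in> borel \<rightarrow>\<^sub>M count_space UNIV"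
    "\<And>n. (\<exists>x. i -` {n} = {x}) \<or> (\<forall>x\<in>i -` {n}. emeasure P {x} = 0)"
    "\<And>x y. x \<in> X \<Longrightarrow> y \<in> X \<Longrightarrow> i x = i y \<Longrightarrow> c x y < e"
proof -
  interpret finite_measure P by fact
  define At where "At = {x. measure P {x} \<noteq> 0}"
  have At: "countable At" unfolding At_def by (rule countable_support)
  obtain B :: "nat \<Rightarrow> 'a set" where B: "\<And>n. open (B n)"
    "\<And>U x. open U \<Longrightarrow> x \<in> U \<Longrightarrow> \<exists>n. x \<in> B n \<and> B n \<subseteq> U"
    using separating_open_sequence by blast
  define small where "small n \<longleftrightarrow> (\<forall>y\<in>X \<inter> B n. \<forall>z\<in>X \<inter> B n. c y z < e)" for n
  have ex: "\<exists>n. small n \<and> x \<in> B n" if x: "x \<in> X" for x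
  proof -
    have "open {..<e}" by simp
    from continuous_on_open_invariant[THEN iffD1, OF c, rule_format, OF this]
    obtain W where W: "open W" "W \<inter> (X \<times> X) = (\<lambda>(x, y). c x y) -` {..<e} \<inter> (X \<times> X)"
      by blast
    have "(x, x) \<in> W" using W(2) x c0[OF x] e by auto
    then obtain U V where UV: "open U" "open V" "x \<in> U" "x \<in> V" "U \<times> V \<subseteq> W"
      using W(1) by (auto elim!: open_prod_elim)
    then obtain n where n: "x \<in> B n" "B n \<subseteq> U \<inter> V"
      using B(2)[of "U \<inter> V" x] by auto
    have "c y z < e" if "y \<in> X \<inter> B n" "z \<in> X \<inter> B n" for y z
    proof -
      have "(y, z) \<in> W \<inter> (X \<times> X)" using that n(2) UV(5) by auto
      then show ?thesis using W(2) by auto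
    qed
    then show ?thesis using n(1) by (auto simp: small_def)
  qed
  define l where "l x = (LEAST n. small n \<and> x \<in> B n)" for x
  \<comment> \<open>Even labels enumerate the atoms and odd labels the diffuse pieces, so the two
    kinds never collide.\<close>
  define i where "i x = (if x \<in> At then 2 * to_nat_on At x else Suc (2 * l x))" for x
  have [measurable]: "B n \<in> sets borel" for n using B(1) by simp
  have l[measurable]: "l \<in> borel \<rightarrow>\<^sub>M count_space UNIV" unfolding l_def by measurable
  have At_sets: "A \<in> sets borel" if "A \<subseteq> At" for A
    using countable_subset[OF that At] by (rule sets.countable[rotated]) simp
  have "i -` {n} \<in> sets borel" for n
  proof -
    have "i -` {n} = (At \<inter> i -` {n}) \<union> ((\<lambda>x. Suc (2 * l x)) -` {n} - At)"
      by (auto simp: i_def)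
    moreover have "(\<lambda>x. Suc (2 * l x)) -` {n} \<inter> space borel \<in> sets borel"
      by (rule measurable_sets[of _ _ "count_space UNIV"]) auto
    then have "(At \<inter> i -` {n}) \<union> ((\<lambda>x. Suc (2 * l x)) -` {n} - At) \<in> sets borel"
      using At_sets[of "At \<inter> i -` {n}"] At_sets[of At] by auto
    ultimately show ?thesis by metis
  qed
  then have "i \<in> borel \<rightarrow>\<^sub>M count_space UNIV"
    by (subst measurable_count_space_eq_countable) auto
  moreover have "(\<exists>x. i -` {n} = {x}) \<or> (\<forall>x\<in>i -` {n}. emeasure P {x} = 0)" for n
  proof (cases "\<exists>x\<in>At. i x = n")
    case True
    then obtain x where x: "x \<in> At" "i x = n" by blast
    have "y = x" if "i y = n" for y
    proof -
      have eq: "i y = i x" using that x by simp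
      have "y \<in> At"
      proof (rule ccontr)
        assume "y \<notin> At"
        then have "Suc (2 * l y) = 2 * to_nat_on At x" using eq x(1) by (simp add: i_def)
        then show False by presburger
      qed
      then show ?thesis using eq x(1) At by (simp add: i_def)
    qed
    then have "i -` {n} = {x}" using x by blast
    then show ?thesis by blast
  next
    case False
    then show ?thesis by (auto simp: At_def emeasure_eq_measure)
  qed
  moreover have "c x y < e" if "x \<in> X" "y \<in> X" "i x = i y" for x y
  proof (cases "x \<in> At \<or> y \<in> At")
    case True
    have "x = y"
    proof -
      have "even (i x) \<longleftrightarrow> x \<in> At" "even (i y) \<longleftrightarrow> y \<in> At" by (auto simp: i_def)
      then show ?thesis using True that(3) At by (auto simp: i_def)
    qed
    then show ?thesis using c0[OF that(1)] e by simp
  next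
    case False
    have "l x = l y" using False that(3) by (simp add: i_def)
    moreover have "small (l z) \<and> z \<in> B (l z)" if "z \<in> X" for z
      unfolding l_def by (rule LeastI_ex[OF ex[OF that]])
    ultimately show ?thesis
      using that(1,2) unfolding small_def by (metis IntI)
  qed
  ultimately show thesis by (rule that)
qed

section \<open>Transport cost zero\<close>

lemma ennreal_powr_mono: "0 \<le> r \<Longrightarrow> a \<le> b \<Longrightarrow> ennreal_powr a r \<le> ennreal_powr b r"
proof (cases "b = \<infinity>")
  case False
  assume "0 \<le> r" "a \<le> b"
  moreover have "a \<noteq> \<infinity>" using False \<open>a \<le> b\<close> by (auto simp: top_unique)
  moreover have "enn2real a \<le> enn2real b"
    using \<open>a \<le> b\<close> False by (intro enn2real_mono) (simp_all add: less_top)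
  ultimately show ?thesis
    using False by (simp add: ennreal_powr_def ennreal_leI powr_mono2)
qed (simp add: ennreal_powr_def)

lemma ennreal_powr_ennreal_powr_inverse:
  "0 < p \<Longrightarrow> 0 \<le> x \<Longrightarrow> ennreal_powr (ennreal (x powr p)) (1 / p) = ennreal x"
proof -
  assume "0 < p" "0 \<le> x"
  then have "(x powr p) powr (1 / p) = x" by (simp add: powr_powr)
  then show ?thesis by (simp add: ennreal_powr_def)
qed

text \<open>
  Disjoint compact sets are at positive cost from each other, so a transport plan of small cost
  cannot move much mass from \<open>L\<close> to \<open>K\<close>.
\<close>

lemma WS_eq_0_imp_eq:
  fixes P Q :: "'a::polish_space measure"
  assumes P: "prob_space P" "sets P = sets (restrict_space borel X)"
    and Q: "prob_space Q" "sets Q = sets (restrict_space borel X)"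
    and X: "X \<in> sets borel" and c: "continuous_on (X \<times> X) (\<lambda>(x, y). c x y)"
    and c_nonneg: "\<And>x y. x \<in> X \<Longrightarrow> y \<in> X \<Longrightarrow> 0 \<le> c x y"
    and c_pos: "\<And>x y. x \<in> X \<Longrightarrow> y \<in> X \<Longrightarrow> c x y = 0 \<Longrightarrow> x = y"
    and p: "0 < p" and WS: "WS c p P Q = 0"
  shows "P = Q"
proof -
  interpret P: prob_space P by fact
  interpret Q: prob_space Q by fact
  have space: "space P = X" "space Q = X"
    using sets_eq_imp_space_eq[OF P(2)] sets_eq_imp_space_eq[OF Q(2)]
    by (simp_all add: space_restrict_space)
  have sets_iff: "A \<in> sets P \<longleftrightarrow> A \<in> sets borel \<and> A \<subseteq> X" "A \<in> sets Q \<longleftrightarrow> A \<in> sets borel \<and> A \<subseteq> X" for A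
    using X by (auto simp: P(2) Q(2) sets_restrict_space_iff)
  \<comment> \<open>A Markov inequality: a map taking mass from \<open>L\<close> to \<open>K\<close>
    pays at least the minimal cost between these sets, which is attained and positive.\<close>
  have compact_le: "measure Q K \<le> measure P (X - L)"
    if K: "compact K" "K \<subseteq> X" and L: "compact L" "L \<subseteq> X" and disj: "K \<inter> L = {}" for K L
  proof (cases "K = {} \<or> L = {}")
    case True
    then show ?thesis using P.prob_space by (auto simp: space)
  next
    case False
    have sK: "K \<in> sets Q" "K \<in> sets P" and sL: "L \<in> sets P"
      using K L by (auto simp: sets_iff borel_compact)
    have "\<exists>z\<in>L \<times> K. \<forall>w\<in>L \<times> K. (case z of (x, y) \<Rightarrow> c x y) \<le> (case w of (x, y) \<Rightarrow> c x y)"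
      using False K L by (intro continuous_attains_inf compact_Times continuous_on_subset[OF c]) auto
    then obtain x0 y0 where xy: "x0 \<in> L" "y0 \<in> K" "\<And>x y. x \<in> L \<Longrightarrow> y \<in> K \<Longrightarrow> c x0 y0 \<le> c x y" by auto
    define d where "d = c x0 y0"
    have "x0 \<in> X" "y0 \<in> X" "x0 \<noteq> y0" using xy(1,2) K(2) L(2) disj by auto
    then have d: "0 < d"
      using c_nonneg[of x0 y0] c_pos[of x0 y0] by (auto simp: d_def less_le)
    have "measure Q K \<le> measure P (X - L) + e" if e: "0 < e" for e
    proof -
      \<comment> \<open>The threshold is the cost of moving mass \<open>e\<close> at unit cost
        \<open>d\<close>, so a map below it moves less than \<open>e\<close> from \<open>L\<close>
        to \<open>K\<close>.\<close>
      have "WS c p P Q < ennreal (d * e powr (1 / p))" using d e by (simp add: WS)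
      then obtain T where T: "T \<in> transport_maps P Q" "expected_cost c p P T < ennreal (d * e powr (1 / p))"
        unfolding WS_def by (auto simp: INF_less_iff)
      have TP: "T \<in> P \<rightarrow>\<^sub>M Q" "distr P Q T = Q" using T(1) by (auto simp: transport_maps_def)
      define A where "A = {x \<in> space P. x \<in> L \<and> T x \<in> K}"
      have A: "A \<in> sets P"
      proof -
        have "A = (T -` K \<inter> space P) \<inter> L" using L by (auto simp: A_def space)
        then show ?thesis using measurable_sets[OF TP(1) sK(1)] sL by auto
      qed
      have "ennreal (d powr p) * emeasure P A \<le> (\<integral>\<^sup>+x. ennreal (c x (T x) powr p) \<partial>P)"
      proof -
        have "ennreal (d powr p) * emeasure P A = (\<integral>\<^sup>+x. ennreal (d powr p) * indicator A x \<partial>P)"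
          using A by (simp add: nn_integral_cmult_indicator)
        also have "\<dots> \<le> (\<integral>\<^sup>+x. ennreal (c x (T x) powr p) \<partial>P)"
          using xy(3) d p
          by (intro nn_integral_mono)
             (auto simp: A_def d_def split: split_indicator intro!: ennreal_leI powr_mono2)
        finally show ?thesis .
      qed
      then have "ennreal_powr (ennreal (d powr p) * emeasure P A) (1 / p) \<le> expected_cost c p P T"
        unfolding expected_cost_def using p by (intro ennreal_powr_mono) auto
      also note T(2)
      also have "ennreal (d powr p) * emeasure P A = ennreal ((d * measure P A powr (1 / p)) powr p)"
        using d p by (simp add: P.emeasure_eq_measure ennreal_mult' powr_mult powr_powr)
      finally have "d * measure P A powr (1 / p) < d * e powr (1 / p)"
        using d p by (simp add: ennreal_powr_ennreal_powr_inverse ennreal_less_iff)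
      then have "measure P A < e"
        using d p e powr_mono2[of "1 / p" e "measure P A"] by (auto simp: not_less[symmetric])
      moreover have "measure Q K = measure P (T -` K \<inter> space P)"
        using measure_distr[OF TP(1) sK(1)] TP(2) by simp
      moreover have "measure P (T -` K \<inter> space P) \<le> measure P ((X - L) \<union> A)"
        using A sL by (intro P.finite_measure_mono) (auto simp: A_def space sets.Un sets.compl_sets[of L P, unfolded space])
      moreover have "measure P ((X - L) \<union> A) \<le> measure P (X - L) + measure P A"
        using A sL by (intro measure_Un_le) (auto simp: sets.compl_sets[of L P, unfolded space])
      ultimately show ?thesis by linarith
    qed
    then show ?thesis by (rule field_le_epsilon)
  qed
  \<comment> \<open>Extension to all Borel sets of the Polish type, where inner regularity is
    available.\<close>
  define P' where "P' = distr P borel (\<lambda>x. x)"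
  define Q' where "Q' = distr Q borel (\<lambda>x. x)"
  have id: "(\<lambda>x. x) \<in> P \<rightarrow>\<^sub>M borel" "(\<lambda>x. x) \<in> Q \<rightarrow>\<^sub>M borel"
    by (auto simp: measurable_def space sets_iff X)
  have P': "measure P' A = measure P A" if "A \<in> sets P" for A
    using that id(1) by (auto simp: P'_def measure_distr space sets_iff Int_absorb2)
  have Q': "measure Q' A = measure Q A" if "A \<in> sets Q" for A
    using that id(2) by (auto simp: Q'_def measure_distr space sets_iff Int_absorb2)
  have fin: "finite_measure P'" "finite_measure Q'"
    using id by (auto simp: P'_def Q'_def intro: P.finite_measure_distr Q.finite_measure_distr)
  have sets': "sets P' = sets borel" "sets Q' = sets borel" by (simp_all add: P'_def Q'_def)
  \<comment> \<open>\<open>K\<close> nearly fills \<open>A\<close> and \<open>L\<close> nearly fills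
    its complement, so the bound for \<open>K\<close> and \<open>L\<close> passes to
    \<open>A\<close> in the limit.\<close>
  have le: "measure Q A \<le> measure P A" if A: "A \<in> sets P" for A
  proof (rule field_le_epsilon)
    fix e :: real assume e: "0 < e"
    have AB: "A \<in> sets borel" "X - A \<in> sets borel" "A \<subseteq> X" using A X by (auto simp: sets_iff)
    obtain K where K: "K \<subseteq> A" "compact K" "measure Q' (A - K) < e / 2"
      using finite_measure_inner_approx[OF fin(2) sets'(2) AB(1), of "e / 2"] e by auto
    obtain L where L: "L \<subseteq> X - A" "compact L" "measure P' (X - A - L) < e / 2"
      using finite_measure_inner_approx[OF fin(1) sets'(1) AB(2), of "e / 2"] e by auto
    have s: "K \<in> sets Q" "A \<in> sets Q" "A - K \<in> sets Q" "X - A - L \<in> sets P" "X - L \<in> sets P"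
      using K L AB X by (auto simp: sets_iff borel_compact sets.Diff)
    have "measure Q A = measure Q K + measure Q (A - K)"
      using Q.finite_measure_Union[of K "A - K"] s K(1) by (simp add: Un_absorb1)
    moreover have "measure Q K \<le> measure P (X - L)"
      using K L AB(3) by (intro compact_le) auto
    moreover have "measure P (X - L) = measure P A + measure P (X - A - L)"
    proof -
      have "X - L = A \<union> (X - A - L)" using AB(3) L(1) by auto
      then show ?thesis using P.finite_measure_Union[of A "X - A - L"] s A by auto
    qed
    ultimately show "measure Q A \<le> measure P A + e"
      using K(3) L(3) P'[OF s(4)] Q'[OF s(3)] by linarith
  qed
  show ?thesis
  proof (rule measure_eqI)
    show "sets P = sets Q" by (simp add: P(2) Q(2))
    fix A assume A: "A \<in> sets P"
    then have AQ: "A \<in> sets Q" by (simp add: sets_iff)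
    have "measure Q (X - A) \<le> measure P (X - A)"
      using le[of "X - A"] sets.compl_sets[OF A] by (simp add: space)
    then have "measure P A \<le> measure Q A"
      using P.prob_compl[OF A] Q.prob_compl[OF AQ] by (simp add: space)
    then show "emeasure P A = emeasure Q A"
      using le[OF A] by (simp add: P.emeasure_eq_measure Q.emeasure_eq_measure)
  qed
qed

section \<open>The two objectives\<close>

text \<open>Pushing forward along the identity extends \<open>P\<close> by zero to the whole Polish
  type, where the results on left inverses and couplings live. The last two facts lead back to
  \<open>P\<close>.\<close>

lemma borel_extension:
  assumes P: "prob_space P" "sets P = sets (restrict_space borel X)" and X: "X \<in> sets borel"
  shows "space P = X" "(\<lambda>x. x) \<in> P \<rightarrow>\<^sub>M borel" "prob_space (distr P borel (\<lambda>x. x))"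
    "\<And>A. A \<in> sets borel \<Longrightarrow> A \<subseteq> X \<Longrightarrow> emeasure (distr P borel (\<lambda>x. x)) A = emeasure P A"
    "\<And>A. A \<in> sets borel \<Longrightarrow> A \<subseteq> X \<Longrightarrow> A \<in> sets P"
    "\<And>h N. h \<in> N \<rightarrow>\<^sub>M borel \<Longrightarrow> h ` space N \<subseteq> X \<Longrightarrow> h \<in> N \<rightarrow>\<^sub>M P"
proof -
  interpret prob_space P by fact
  show space: "space P = X"
    using sets_eq_imp_space_eq[OF P(2)] by (simp add: space_restrict_space)
  show s: "A \<in> sets P" if "A \<in> sets borel" "A \<subseteq> X" for A
    using that X by (simp add: P(2) sets_restrict_space_iff)
  show id: "(\<lambda>x. x) \<in> P \<rightarrow>\<^sub>M borel"
    by (intro measurableI) (use X space s in auto)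
  show "prob_space (distr P borel (\<lambda>x. x))"
    using id by (rule prob_space_distr)
  show "emeasure (distr P borel (\<lambda>x. x)) A = emeasure P A" if "A \<in> sets borel" "A \<subseteq> X" for A
    using that id by (simp add: emeasure_distr space Int_absorb2)
  show "h \<in> N \<rightarrow>\<^sub>M P" if "h \<in> N \<rightarrow>\<^sub>M borel" "h ` space N \<subseteq> X" for h N
  proof -
    have "h \<in> N \<rightarrow>\<^sub>M restrict_space borel X"
      using that by (intro measurable_restrict_space2) auto
    then show ?thesis using P(2) by (simp cong: measurable_cong_sets)
  qed
qed

lemma WS_self:
  assumes "\<And>x. x \<in> space P \<Longrightarrow> c x x = 0"
  shows "WS c p P P = 0"
proof -
  have "(\<lambda>x. x) \<in> transport_maps P P" by (simp add: transport_maps_def distr_id2)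
  then have "WS c p P P \<le> expected_cost c p P (\<lambda>x. x)"
    unfolding WS_def by (rule INF_lower)
  also have "(\<integral>\<^sup>+x. ennreal (c x x powr p) \<partial>P) = (\<integral>\<^sup>+x. 0 \<partial>P)"
    using assms by (intro nn_integral_cong) simp
  then have "expected_cost c p P (\<lambda>x. x) = 0"
    by (simp add: expected_cost_def ennreal_powr_def)
  finally show ?thesis by simp
qed

lemma distr_matching_maps:
  assumes "H1 \<in> injective_maps Pt" "H2 \<in> borel \<rightarrow>\<^sub>M Ps" "G1 \<in> matching_maps Pt Ps H1"
  shows "distr Pt Ps (H2 \<circ> H1) = distr Ps Ps (H2 \<circ> G1)"
proof -
  have "distr Pt Ps (H2 \<circ> H1) = distr (distr Pt borel H1) Ps H2"
    using assms by (intro distr_distr[symmetric]) (auto simp: injective_maps_def)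
  also have "\<dots> = distr (distr Ps borel G1) Ps H2"
    using assms(3) by (simp add: matching_maps_def)
  also have "\<dots> = distr Ps Ps (H2 \<circ> G1)"
    using assms by (intro distr_distr) (auto simp: matching_maps_def injective_maps_def)
  finally show ?thesis .
qed

text \<open>Each \<open>H2 \<circ> G1\<close> is itself a transport map from \<open>Ps\<close> to
  the law of \<open>H2 \<circ> H1\<close>. The direction is opposite to that of
  \<open>WS_objective\<close>, and transport by maps is not symmetric, so only the value zero is
  passed on.\<close>

lemma WS_le_reconstruction_objective:
  assumes "(H1, H2) \<in> admissible_pairs Pt Ps"
  shows "WS c p Ps (distr Pt Ps (H2 \<circ> H1)) \<le> reconstruction_objective c p Pt Ps (H1, H2)"
  unfolding reconstruction_objective_def prod.case
proof (rule INF_greatest)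
  fix G1 assume G1: "G1 \<in> matching_maps Pt Ps H1"
  have H: "H1 \<in> injective_maps Pt" "H2 \<in> borel \<rightarrow>\<^sub>M Ps"
    using assms by (auto simp: admissible_pairs_def)
  have "H2 \<circ> G1 \<in> Ps \<rightarrow>\<^sub>M Ps"
    using H(2) G1 by (auto simp: matching_maps_def injective_maps_def intro: measurable_comp)
  then have "H2 \<circ> G1 \<in> transport_maps Ps (distr Pt Ps (H2 \<circ> H1))"
    using distr_matching_maps[OF H G1]
    by (auto simp: transport_maps_def intro: distr_cong)
  then show "WS c p Ps (distr Pt Ps (H2 \<circ> H1)) \<le> expected_cost c p Ps (H2 \<circ> G1)"
    unfolding WS_def by (rule INF_lower)
qed

text \<open>Take for \<open>H2\<close> an almost everywhere left inverse of \<open>G1\<close>: it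
  reconstructs at cost zero and gives \<open>H2 \<circ> H1\<close> the law
  \<open>Ps\<close>.\<close>

lemma ex_zero_objectives:
  fixes Ps :: "'s::polish_space measure" and H1 :: "'t \<Rightarrow> 'z::{polish_space, zero}"
  assumes Ps: "prob_space Ps" "sets Ps = sets (restrict_space borel X)" and X: "X \<in> sets borel"
    and c0: "\<And>x. x \<in> X \<Longrightarrow> c x x = 0"
    and H1: "H1 \<in> injective_maps Pt" and G1: "G1 \<in> matching_maps Pt Ps H1"
  obtains H2 where "(H1, H2) \<in> admissible_pairs Pt Ps" "WS_objective c p Pt Ps (H1, H2) = 0"
    "reconstruction_objective c p Pt Ps (H1, H2) = 0"
proof -
  interpret prob_space Ps by fact
  note ext = borel_extension[OF Ps X]
  let ?P = "distr Ps borel (\<lambda>x. x)"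
  interpret P: prob_space ?P by (rule ext)
  obtain x0 where x0: "x0 \<in> X" using not_empty ext(1) by auto
  have G1': "G1 \<in> borel_measurable Ps" "inj_on G1 X"
    using G1 by (auto simp: matching_maps_def injective_maps_def ext(1))
  \<comment> \<open>Extension by 0 gives a Borel map on the whole type, as the left inverse lemma
    requires.\<close>
  define G where "G x = (if x \<in> X then G1 x else 0)" for x
  have "G1 \<in> borel_measurable (restrict_space borel X)"
    using G1'(1) Ps(2) by (simp cong: measurable_cong_sets)
  then have G: "G \<in> borel_measurable borel"
    unfolding G_def using X by (subst (asm) measurable_restrict_space_iff[where c=0]) auto
  have inj: "inj_on G X" using G1'(2) by (simp add: G_def inj_on_def)
  obtain X' h where h: "X' \<in> sets borel" "X' \<subseteq> X" "emeasure ?P (X - X') = 0"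
    "G ` X' \<in> sets borel" "h \<in> borel_measurable borel" "range h \<subseteq> X" "\<And>x. x \<in> X' \<Longrightarrow> h (G x) = x"
    by (rule ex_borel_left_inverse_AE[OF P.finite_measure_axioms sets_distr X G inj x0]) (rule that)
  have hPs: "h \<in> borel \<rightarrow>\<^sub>M Ps" using h(5,6) by (intro ext(6)) auto
  have "X - X' \<in> null_sets Ps"
    using h(1-3) X ext(4)[of "X - X'"] ext(5)[of "X - X'"] by auto
  then have ae: "AE x in Ps. h (G1 x) = x"
    by (rule AE_I') (use h(2,7) in \<open>force simp: ext(1) G_def\<close>)
  have adm: "(H1, h) \<in> admissible_pairs Pt Ps" using H1 hPs by (simp add: admissible_pairs_def)
  have "reconstruction_objective c p Pt Ps (H1, h) \<le> expected_cost c p Ps (h \<circ> G1)"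
    unfolding reconstruction_objective_def prod.case using G1 by (rule INF_lower)
  also have "(\<integral>\<^sup>+x. ennreal (c x ((h \<circ> G1) x) powr p) \<partial>Ps) = (\<integral>\<^sup>+x. 0 \<partial>Ps)"
    using ae AE_space by (intro nn_integral_cong_AE, eventually_elim) (simp add: c0 ext(1))
  then have "expected_cost c p Ps (h \<circ> G1) = 0"
    by (simp add: expected_cost_def ennreal_powr_def)
  finally have "reconstruction_objective c p Pt Ps (H1, h) = 0" by simp
  moreover have "distr Pt Ps (h \<circ> H1) = Ps"
  proof -
    have "distr Pt Ps (h \<circ> H1) = distr Ps Ps (h \<circ> G1)"
      by (rule distr_matching_maps[OF H1 hPs G1])
    also have "\<dots> = distr Ps Ps (\<lambda>x. x)"
      using ae measurable_comp[OF G1'(1) hPs] by (intro distr_cong_AE) auto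
    finally show ?thesis by (simp add: distr_id2)
  qed
  then have "WS_objective c p Pt Ps (H1, h) = 0"
    unfolding WS_objective_def using WS_self[of Ps c p] c0 by (simp add: ext(1))
  ultimately show thesis using that adm by blast
qed

text \<open>The pair \<open>H\<close>, \<open>G\<close> may be unrelated to \<open>H1\<close>; it
  serves to compare the atoms of \<open>Pt\<close> and \<open>Ps\<close>, which forces
  \<open>H2\<close> to preserve atoms. Injective maps \<open>G1\<close> with error below any
  \<open>e\<close> follow, so the infimum is zero whether or not it is attained.\<close>

lemma reconstruction_objective_eq_0:
  fixes Ps :: "'s::polish_space measure" and H1 :: "'t \<Rightarrow> real ^ 'm"
  assumes Ps: "prob_space Ps" "sets Ps = sets (restrict_space borel X)" and X: "X \<in> sets borel"
    and Pt: "prob_space Pt"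
    and c: "continuous_on (X \<times> X) (\<lambda>(x, y). c x y)"
    and c_nonneg: "\<And>x y. x \<in> X \<Longrightarrow> y \<in> X \<Longrightarrow> 0 \<le> c x y"
    and c0: "\<And>x. x \<in> X \<Longrightarrow> c x x = 0" and p: "0 < p"
    and feasible: "H \<in> injective_maps Pt" "G \<in> matching_maps Pt Ps (H :: 't \<Rightarrow> real ^ 'm)"
    and adm: "(H1, H2) \<in> admissible_pairs Pt Ps" and law: "distr Pt Ps (H2 \<circ> H1) = Ps"
  shows "reconstruction_objective c p Pt Ps (H1, H2) = 0"
proof -
  interpret Ps: prob_space Ps by fact
  interpret Pt: prob_space Pt by fact
  note ext = borel_extension[OF Ps X]
  let ?P = "distr Ps borel (\<lambda>x. x)"
  let ?N = "distr Pt borel H1"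
  have H1: "H1 \<in> borel_measurable Pt" "inj_on H1 (space Pt)" and H2: "H2 \<in> borel \<rightarrow>\<^sub>M Ps"
    using adm by (auto simp: admissible_pairs_def injective_maps_def)
  have H2b: "H2 \<in> borel \<rightarrow>\<^sub>M borel" using measurable_compose[OF H2 ext(2)] .
  have H2X: "H2 z \<in> X" for z using measurable_space[OF H2, of z] by (simp add: ext(1))
  have N: "prob_space ?N" using H1(1) by (rule Pt.prob_space_distr)
  have NP: "distr ?N borel H2 = ?P"
  proof -
    have "distr ?N borel H2 = distr Pt borel (H2 \<circ> H1)"
      using H1(1) H2b by (intro distr_distr)
    also have "\<dots> = distr (distr Pt Ps (H2 \<circ> H1)) borel (\<lambda>x. x)"
      using measurable_comp[OF H1(1) H2] ext(2) by (subst distr_distr) (auto simp: comp_def)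
    finally show ?thesis by (simp add: law)
  qed
  \<comment> \<open>The squared atom sum passes from the law of \<open>H1\<close> through
    \<open>Pt\<close>, the common law of \<open>H\<close> and \<open>G\<close>, and
    \<open>Ps\<close> to the extension of \<open>Ps\<close>.\<close>
  have "(\<integral>\<^sup>+x. emeasure ?N {x} \<partial>?N) = (\<integral>\<^sup>+x. emeasure Pt {x} \<partial>Pt)"
    using H1 Pt.finite_measure_axioms by (intro nn_integral_emeasure_singleton_distr)
  also have "\<dots> = (\<integral>\<^sup>+x. emeasure (distr Pt borel H) {x} \<partial>distr Pt borel H)"
    using feasible(1) Pt.finite_measure_axioms
    by (intro nn_integral_emeasure_singleton_distr[symmetric]) (auto simp: injective_maps_def)
  also have "distr Pt borel H = distr Ps borel G"
    using feasible(2) by (simp add: matching_maps_def)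
  also have "(\<integral>\<^sup>+x. emeasure (distr Ps borel G) {x} \<partial>distr Ps borel G) = (\<integral>\<^sup>+x. emeasure Ps {x} \<partial>Ps)"
    using feasible(2) Ps.finite_measure_axioms
    by (intro nn_integral_emeasure_singleton_distr) (auto simp: matching_maps_def injective_maps_def)
  also have "\<dots> = (\<integral>\<^sup>+x. emeasure ?P {x} \<partial>?P)"
    using ext(2) Ps.finite_measure_axioms
    by (intro nn_integral_emeasure_singleton_distr[symmetric]) auto
  finally have atoms: "AE z in ?N. emeasure ?N {z} = emeasure ?P {H2 z}"
    using distr_preserves_atoms[OF N _ H2b] by (simp add: NP)
  have "reconstruction_objective c p Pt Ps (H1, H2) \<le> 0 + ennreal e" if e: "0 < e" for e
  proof -
    interpret P: prob_space ?P by (rule ext)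
    obtain i :: "'s \<Rightarrow> nat" where i: "i \<in> borel \<rightarrow>\<^sub>M count_space UNIV"
      "\<And>n. (\<exists>x. i -` {n} = {x}) \<or> (\<forall>x\<in>i -` {n}. emeasure ?P {x} = 0)"
      "\<And>x y. x \<in> X \<Longrightarrow> y \<in> X \<Longrightarrow> i x = i y \<Longrightarrow> c x y < e"
      by (rule ex_small_partition_isolating_atoms[OF P.finite_measure_axioms c c0 e])
        (assumption | rule that)+
    obtain G1 where G1: "G1 \<in> borel \<rightarrow>\<^sub>M borel" "inj G1" "distr ?P borel G1 = ?N"
      "AE x in ?P. i (H2 (G1 x)) = i x"
      by (rule injective_coupling_along_partition[OF ext(3) N sets_distr H2b NP atoms i(1,2)]) (rule that)
    have G1s: "G1 \<in> borel_measurable Ps" using measurable_compose[OF ext(2) G1(1)] .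
    have "distr Ps borel G1 = ?N"
      using distr_distr[OF G1(1) ext(2)] G1(3) by (simp add: comp_def)
    then have "G1 \<in> matching_maps Pt Ps H1"
      using G1s inj_on_subset[OF G1(2) subset_UNIV]
      by (simp add: matching_maps_def injective_maps_def)
    then have "reconstruction_objective c p Pt Ps (H1, H2) \<le> expected_cost c p Ps (H2 \<circ> G1)"
      unfolding reconstruction_objective_def prod.case by (rule INF_lower)
    also have "\<dots> \<le> ennreal_powr (ennreal (e powr p)) (1 / p)"
      unfolding expected_cost_def
    proof (rule ennreal_powr_mono)
      have "AE x in Ps. i (H2 (G1 x)) = i x" using AE_distrD[OF ext(2) G1(4)] .
      then have "AE x in Ps. ennreal (c x ((H2 \<circ> G1) x) powr p) \<le> ennreal (e powr p)"
        using AE_space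
      proof eventually_elim
        case (elim x)
        then have "c x (H2 (G1 x)) < e" "0 \<le> c x (H2 (G1 x))"
          using H2X by (auto simp: ext(1) intro!: i(3) c_nonneg)
        then show ?case using p by (auto intro!: ennreal_leI powr_mono2)
      qed
      then have "(\<integral>\<^sup>+x. ennreal (c x ((H2 \<circ> G1) x) powr p) \<partial>Ps) \<le> (\<integral>\<^sup>+x. ennreal (e powr p) \<partial>Ps)"
        by (rule nn_integral_mono_AE)
      also have "\<dots> = ennreal (e powr p)" by (simp add: Ps.emeasure_space_1)
      finally show "(\<integral>\<^sup>+x. ennreal (c x ((H2 \<circ> G1) x) powr p) \<partial>Ps) \<le> ennreal (e powr p)" .
    qed (use p in simp)
    also have "\<dots> = ennreal e" using p e by (simp add: ennreal_powr_ennreal_powr_inverse)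
    finally show ?thesis by simp
  qed
  then have "reconstruction_objective c p Pt Ps (H1, H2) \<le> 0"
    by (rule ennreal_le_epsilon)
  then show ?thesis by simp
qed

text \<open>Both conditions mean that the law of \<open>H2 \<circ> H1\<close> is
  \<open>Ps\<close>.\<close>

lemma objectives_eq_0_iff:
  fixes Ps :: "'s::polish_space measure" and H :: "('t \<Rightarrow> real ^ 'm) \<times> (real ^ 'm \<Rightarrow> 's)"
  assumes Ps: "prob_space Ps" "sets Ps = sets (restrict_space borel X)" and X: "X \<in> sets borel"
    and Pt: "prob_space Pt"
    and c: "continuous_on (X \<times> X) (\<lambda>(x, y). c x y)"
    and c_nonneg: "\<And>x y. x \<in> X \<Longrightarrow> y \<in> X \<Longrightarrow> 0 \<le> c x y"
    and c0: "\<And>x. x \<in> X \<Longrightarrow> c x x = 0" and p: "0 < p"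
    and c_pos: "\<And>x y. x \<in> X \<Longrightarrow> y \<in> X \<Longrightarrow> c x y = 0 \<Longrightarrow> x = y"
    and feasible: "H' \<in> injective_maps Pt" "G \<in> matching_maps Pt Ps (H' :: 't \<Rightarrow> real ^ 'm)"
    and adm: "H \<in> admissible_pairs Pt Ps"
  shows "WS_objective c p Pt Ps H = 0 \<longleftrightarrow> reconstruction_objective c p Pt Ps H = 0"
proof -
  obtain H1 H2 where H: "H = (H1, H2)" by (cases H)
  let ?law = "distr Pt Ps (H2 \<circ> H1)"
  have "H2 \<circ> H1 \<in> Pt \<rightarrow>\<^sub>M Ps"
    using adm unfolding H admissible_pairs_def injective_maps_def by (auto intro: measurable_comp)
  with Pt have law: "prob_space ?law" by (rule prob_space.prob_space_distr)
  have sets: "sets ?law = sets (restrict_space borel X)" using Ps(2) by simp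
  have space: "space Ps = X" by (rule borel_extension(1)[OF Ps X])
  show ?thesis
  proof
    assume "WS_objective c p Pt Ps H = 0"
    then have WS: "WS c p ?law Ps = 0" by (simp add: H WS_objective_def)
    have "?law = Ps"
      by (rule WS_eq_0_imp_eq[OF law sets Ps X c c_nonneg c_pos p WS])
    with adm show "reconstruction_objective c p Pt Ps H = 0"
      unfolding H by (intro reconstruction_objective_eq_0[OF Ps X Pt c c_nonneg c0 p feasible])
  next
    assume "reconstruction_objective c p Pt Ps H = 0"
    then have WS: "WS c p Ps ?law = 0"
      using WS_le_reconstruction_objective[of H1 H2 Pt Ps c p] adm by (simp add: H)
    \<comment> \<open>Here the zero cost runs from \<open>Ps\<close> to the law, so the two measures
      exchange roles.\<close>
    have "Ps = ?law"
      by (rule WS_eq_0_imp_eq[OF Ps law sets X c c_nonneg c_pos p WS])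
    then have "?law = Ps" ..
    then show "WS_objective c p Pt Ps H = 0"
      using WS_self[of Ps c p] c0 by (simp add: H WS_objective_def space)
  qed
qed

text \<open>Zero is the least value in \<open>ennreal\<close>, so once it is attained the minimisers
  are exactly the zeros.\<close>

lemma is_arg_min_eq_0_iff:
  fixes f :: "'a \<Rightarrow> ennreal"
  assumes "P y" "f y = 0"
  shows "is_arg_min f P x \<longleftrightarrow> P x \<and> f x = 0"
proof -
  have "f x = 0" if "\<not> f y < f x" using that assms(2) by (simp add: not_less)
  then show ?thesis using assms(1) by (auto simp: is_arg_min_def)
qed

theorem theorem6:
  fixes Ps :: "'s::polish_space measure" and Xs :: "'s set"
    and Pt :: "'t measure"
    and c :: "'s \<Rightarrow> 's \<Rightarrow> real" and p :: real
  assumes "prob_space Ps" and "prob_space Pt"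
    and "Xs \<in> sets borel" and "sets Ps = sets (restrict_space borel Xs)"
    and "(\<lambda>(x, y). c x y) \<in> borel_measurable (Ps \<Otimes>\<^sub>M Ps)"
    and "\<And>x y. x \<in> Xs \<Longrightarrow> y \<in> Xs \<Longrightarrow> 0 \<le> c x y"
    and "\<And>x. x \<in> Xs \<Longrightarrow> c x x = 0"
    and "0 < p"
    and feasible: "\<exists>H1 \<in> injective_maps Pt. matching_maps Pt Ps (H1 :: 't \<Rightarrow> real ^ 'm) \<noteq> {}"
  shows "(INF H \<in> (admissible_pairs Pt Ps :: (('t \<Rightarrow> real ^ 'm) \<times> (real ^ 'm \<Rightarrow> 's)) set).
            WS_objective c p Pt Ps H) =
         (INF H \<in> (admissible_pairs Pt Ps :: (('t \<Rightarrow> real ^ 'm) \<times> (real ^ 'm \<Rightarrow> 's)) set).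
            reconstruction_objective c p Pt Ps H)
       \<and> (continuous_on (Xs \<times> Xs) (\<lambda>(x, y). c x y) \<and> (\<forall>x\<in>Xs. \<forall>y\<in>Xs. c x y = 0 \<longrightarrow> x = y) \<longrightarrow>
           (\<forall>H :: ('t \<Rightarrow> real ^ 'm) \<times> (real ^ 'm \<Rightarrow> 's).
              is_arg_min (WS_objective c p Pt Ps) (\<lambda>H. H \<in> admissible_pairs Pt Ps) H \<longleftrightarrow>
              is_arg_min (reconstruction_objective c p Pt Ps) (\<lambda>H. H \<in> admissible_pairs Pt Ps) H))"
proof -
  obtain H1 :: "'t \<Rightarrow> real ^ 'm" and G1 where H1: "H1 \<in> injective_maps Pt" "G1 \<in> matching_maps Pt Ps H1"
    using feasible by blast
  \<comment> \<open>One pair at which both objectives vanish: it gives both infima the value zero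
    and is the reference minimiser of each problem.\<close>
  obtain H2 where H2: "(H1, H2) \<in> admissible_pairs Pt Ps" "WS_objective c p Pt Ps (H1, H2) = 0"
    "reconstruction_objective c p Pt Ps (H1, H2) = 0"
    by (rule ex_zero_objectives[OF assms(1,4,3,7) H1])
  have INF_0: "(INF H\<in>admissible_pairs Pt Ps. f H) = 0"
    if "f (H1, H2) = 0" for f :: "('t \<Rightarrow> real ^ 'm) \<times> (real ^ 'm \<Rightarrow> 's) \<Rightarrow> ennreal"
    using INF_lower[OF H2(1), of f] that by simp
  show ?thesis
  proof (intro conjI impI allI)
    show "(INF H\<in>(admissible_pairs Pt Ps :: (('t \<Rightarrow> real ^ 'm) \<times> (real ^ 'm \<Rightarrow> 's)) set).
        WS_objective c p Pt Ps H) =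
      (INF H\<in>(admissible_pairs Pt Ps :: (('t \<Rightarrow> real ^ 'm) \<times> (real ^ 'm \<Rightarrow> 's)) set).
        reconstruction_objective c p Pt Ps H)"
      unfolding INF_0[of "WS_objective c p Pt Ps", OF H2(2)]
        INF_0[of "reconstruction_objective c p Pt Ps", OF H2(3)] ..
  next
    fix H :: "('t \<Rightarrow> real ^ 'm) \<times> (real ^ 'm \<Rightarrow> 's)"
    assume *: "continuous_on (Xs \<times> Xs) (\<lambda>(x, y). c x y) \<and> (\<forall>x\<in>Xs. \<forall>y\<in>Xs. c x y = 0 \<longrightarrow> x = y)"
    have "WS_objective c p Pt Ps H = 0 \<longleftrightarrow> reconstruction_objective c p Pt Ps H = 0"
      if "H \<in> admissible_pairs Pt Ps"
      using * by (intro objectives_eq_0_iff[OF assms(1,4,3,2) _ assms(6,7,8) _ H1 that]) auto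
    then show "is_arg_min (WS_objective c p Pt Ps) (\<lambda>H. H \<in> admissible_pairs Pt Ps) H \<longleftrightarrow>
        is_arg_min (reconstruction_objective c p Pt Ps) (\<lambda>H. H \<in> admissible_pairs Pt Ps) H"
      unfolding
        is_arg_min_eq_0_iff[of "\<lambda>H. H \<in> admissible_pairs Pt Ps" _ "WS_objective c p Pt Ps", OF H2(1,2)]
        is_arg_min_eq_0_iff[of "\<lambda>H. H \<in> admissible_pairs Pt Ps" _ "reconstruction_objective c p Pt Ps", OF H2(1,3)]
      by blast
  qed
qed

end
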